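(* Let $n\ge1$ be an integer and $t>0$. Let $X_3$ be the pseudo-process associated with the third-order equation $\frac{\partial u}{\partial t}=-\frac{\partial^3u}{\partial x^3}$, and let $T^j_{1/3}$, $j=1,2,\ldots,n$, be independent positively skewed stable random variables (subordinators) of order $\frac13$, each with law $$\Pr\{T^j_{1/3}(t)\in ds\}=\frac{t}{s}\,\frac{1}{\sqrt[3]{3s}}\,\mathrm{Ai}\left(\frac{t}{\sqrt[3]{3s}}\right)ds,\qquad s,t>0.$$ Then the random variable $$Z_n(t)=X_3\left(T^1_{1/3}\left(\ldots\left(T^n_{1/3}(t)\right)\ldots\right)\right)$$ has characteristic function, for $\beta\in\mathbb{R}$, $$E e^{i\beta Z_n(t)}=\exp\left[-t|\beta|^{\frac{1}{3^{n-1}}}\left(\cos\frac{\pi}{2\cdot3^n}+i\,\mathrm{sgn}(\beta)\sin\frac{\pi}{2\cdot3^n}\right)\right]=\exp\left[-t|\beta|^{\frac{1}{3^{n-1}}}\cos\frac{\pi}{2\cdot3^n}\left(1+i\,\mathrm{sgn}(\beta)\tan\frac{\pi}{2\cdot3^n}\right)\right].$$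
   Context: $\mathrm{Ai}$ is the Airy function of the first kind. The pseudo-process $X_3$ has as its (sign-varying) one-dimensional "density" at time $s>0$ the fundamental solution $u_3(x,s)=\frac{1}{\sqrt[3]{3s}}\mathrm{Ai}\left(\frac{x}{\sqrt[3]{3s}}\right)$ of $\frac{\partial u}{\partial s}=-\frac{\partial^3u}{\partial x^3}$, $u(x,0)=\delta(x)$, whose Fourier transform is $\int_{\mathbb{R}}e^{i\beta x}u_3(x,s)\,dx=e^{-is\beta^3}$. The stable law of order $\frac13$ above has Laplace transform $E e^{-\lambda T_{1/3}(t)}=e^{-t\lambda^{1/3}}$, $\lambda\ge0$. The pseudo-process $X_3$ is independent of the $T^j_{1/3}$, and the law of the composition $Z_n(t)$ is by definition the one with density $$\frac{\Pr\{Z_n(t)\in dx\}}{dx}=\int_0^\infty\!\!\cdots\int_0^\infty u_3(x,s_1)\,h(s_1,s_2)\,h(s_2,s_3)\cdots h(s_n,s_{n+1})\,ds_1\cdots ds_n,\qquad s_{n+1}=t,$$ where $h(s,r)=\frac{r}{s}\frac{1}{\sqrt[3]{3s}}\mathrm{Ai}\left(\frac{r}{\sqrt[3]{3s}}\right)$ is the density at $s$ of $T_{1/3}(r)$. The characteristic function $E e^{i\beta Z_n(t)}$ is the Fourier transform $\int_{\mathbb{R}}e^{i\beta x}\Pr\{Z_n(t)\in dx\}$. *)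

theory Defs
  imports "HOL-Analysis.Analysis"
begin

text \<open>
  The Airy function of the first kind on the real line. The integral converges only
  conditionally, so it is written as an improper (limit of proper) integral rather than
  as a Lebesgue integral over the half-line.
\<close>

definition Airy_Ai :: "real \<Rightarrow> real" where
  "Airy_Ai x = Lim at_top (\<lambda>R. integral {0..R} (\<lambda>w. cos (w ^ 3 / 3 + x * w))) / pi"

text \<open>
  Fundamental solution of \<open>\<partial>u/\<partial>s = - \<partial>\<^sup>3u/\<partial>x\<^sup>3\<close> for \<open>s > 0\<close>: the sign-varying one-dimensional
  density at time \<open>s\<close> of the pseudo-process \<open>X\<^sub>3\<close>.
\<close>

definition X3_density :: "real \<Rightarrow> real \<Rightarrow> real" where
  "X3_density x s = 1 / root 3 (3 * s) * Airy_Ai (x / root 3 (3 * s))"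

text \<open>
  Density at \<open>s > 0\<close> of the positively skewed stable variable \<open>T\<^sub>1\<^sub>/\<^sub>3(r)\<close>, \<open>r > 0\<close>.
\<close>

definition T_density :: "real \<Rightarrow> real \<Rightarrow> real" where
  "T_density s r = r / s * (1 / root 3 (3 * s)) * Airy_Ai (r / root 3 (3 * s))"

text \<open>
  Density at \<open>x\<close> of \<open>Z\<^sub>n(t) = X\<^sub>3(T\<^sup>1(\<dots>T\<^sup>n(t)\<dots>))\<close>, with \<open>Z\<^sub>0 = X\<^sub>3\<close>. Since \<open>X\<^sub>3\<close> is only a
  pseudo-process, this iterated integral is what the law of the composition means.
  The recursion adds the outermost integration: with \<open>s\<^sub>n\<^sub>+\<^sub>1 = t\<close>, unfolding it gives
  \<open>\<integral>\<dots>\<integral> u\<^sub>3(x,s\<^sub>1) h(s\<^sub>1,s\<^sub>2) \<dots> h(s\<^sub>n,s\<^sub>n\<^sub>+\<^sub>1) ds\<^sub>1 \<dots> ds\<^sub>n\<close> over \<open>(0,\<infinity>)\<^sup>n\<close>, where \<open>u\<^sub>3\<close> is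
  \<open>X3_density\<close>, \<open>h\<close> is \<open>T_density\<close>, and \<open>s\<^sub>1\<close> is integrated first.
\<close>

fun Z_density :: "nat \<Rightarrow> real \<Rightarrow> real \<Rightarrow> real" where
  "Z_density 0 x t = X3_density x t"
| "Z_density (Suc n) x t = (LBINT s:{0<..}. Z_density n x s * T_density s t)"

text \<open>
  Characteristic function of a possibly sign-varying law given by its density. The
  library's \<open>char\<close> applies to nonnegative measures only. A density that is not Lebesgue
  integrable would receive the value \<open>0\<close>.
\<close>

definition char_of_density :: "(real \<Rightarrow> real) \<Rightarrow> real \<Rightarrow> complex" where
  "char_of_density p \<beta> = (CLBINT x. exp (\<i> * of_real (\<beta> * x)) * of_real (p x))"

end

theory Submission
  imports Defs "HOL-Complex_Analysis.Complex_Analysis" "HOL-Probability.Sinc_Integral"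
begin

text \<open>
  Write \<open>Ai\<close> as the absolutely convergent integral of \<open>exp (v\<^sup>3/3 - x v) / (2 pi)\<close> over any line
  \<open>Re v = c > 0\<close>. This yields \<open>Ai'' = x Ai\<close> and, since \<open>c\<close> is arbitrary, bounds
  \<open>C\<^sub>c exp (-c x)\<close> valid on the whole real line. Fubini's theorem and Cauchy's formula on a
  half-plane then give the Laplace transform of \<open>T_density\<close>, namely \<open>exp (- t z\<^sup>1\<^sup>/\<^sup>3)\<close> for
  \<open>Re z \<ge> 0\<close>.

  Since \<open>X3_density\<close> is not Lebesgue integrable in \<open>x\<close>, one cannot integrate its Fourier transform
  against \<open>T_density\<close>. Instead \<open>Z\<^sub>1\<close> is computed in closed form: the Wronskian of \<open>Ai (x y)\<close> and
  \<open>Ai (t y)\<close> is a primitive in \<open>y\<close> of the integrand, so that \<open>Z\<^sub>1\<close> is the skewed Cauchy density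
  \<open>(\<surd>3 / 2 pi) t / (t\<^sup>2 + t x + x\<^sup>2)\<close>, whose Fourier transform is again a half-plane Cauchy
  integral. From then on everything is absolutely integrable, and each further composition takes the
  principal cube root of the exponent.
\<close>

section \<open>Absolutely convergent integrals depending on a parameter\<close>

text \<open>On the negative axis \<open>Ai\<close> oscillates with an amplitude of order |x|^(-1/4),
  hence the failure of absolute integrability. Shifting the contour helps because Re ((c + i r)^3) =
  c^3 - 3 c r^2 gives Gaussian decay in r, while on the imaginary axis the integrand has modulus 1.

  The cube root arises as a pole: integrating exp (- (z - v^3) s) over s leaves 1 / (z - v^3), and
  of its three poles only the principal root lies to the right of the line. That root maps the
  closed right half-plane into the sector |arg| <= pi / 6, so the exponent of one composition is an
  admissible Laplace variable for the next.

  The constant sqrt 3 / (2 pi) is -3 Ai(0) Ai'(0). Both values are read off the Laplace transform at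
  z = 1: from t = 0, and from its t-derivative at 0. Each interchange of integrals in the induction
  rests on an L1 bound that is uniform in time.\<close>

lemma integrable_inverse_quadratic:
  fixes a b :: real
  assumes "a > 0" "b > 0"
  shows "integrable lborel (\<lambda>r. 1 / (a + b * r\<^sup>2))"
proof (rule Bochner_Integration.integrable_bound)
  let ?C = "max (1 / a) (1 / b)"
  have "set_integrable lborel (einterval (-\<infinity>) \<infinity>) (\<lambda>x::real. inverse (1 + x\<^sup>2))"
    by (rule integrable_inverse_1_plus_square)
  then have "integrable lborel (\<lambda>x::real. inverse (1 + x\<^sup>2))"
    by (simp add: set_integrable_def einterval_eq)
  then show "integrable lborel (\<lambda>x::real. ?C * inverse (1 + x\<^sup>2))"
    by (rule integrable_mult_right)
  show "AE r in lborel. norm (1 / (a + b * r\<^sup>2)) \<le> norm (?C * inverse (1 + r\<^sup>2))"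
  proof (rule AE_I2)
    fix r :: real
    have 1: "1 \<le> ?C * a" "1 \<le> ?C * b"
      using assms by (auto simp: max_def field_simps)
    have "1 + r\<^sup>2 \<le> ?C * a + ?C * b * r\<^sup>2"
      using 1 mult_right_mono[OF 1(2), of "r\<^sup>2"] by simp
    then have "1 + r\<^sup>2 \<le> ?C * (a + b * r\<^sup>2)"
      by (simp only: distrib_left mult.assoc)
    moreover have "0 < 1 + r\<^sup>2" "0 < a + b * r\<^sup>2" "?C > 0"
      using assms by (auto simp: add_pos_nonneg less_max_iff_disj)
    ultimately show "norm (1 / (a + b * r\<^sup>2)) \<le> norm (?C * inverse (1 + r\<^sup>2))"
      by (simp add: abs_of_pos abs_of_nonneg field_simps)
  qed
qed simp

text \<open>K |r| <= K^2 / (2 c) + (c / 2) r^2 absorbs the linear term into half of the quadratic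
  one, and exp (-u) <= 1 / (1 + u) then reduces the Gaussian to
  \<open>integrable_inverse_quadratic\<close>.\<close>

lemma integrable_exp_abs_minus_square:
  fixes c K :: real
  assumes "c > 0"
  shows "integrable lborel (\<lambda>r. exp (K * \<bar>r\<bar> - c * r\<^sup>2))"
proof (rule Bochner_Integration.integrable_bound)
  let ?M = "exp (K\<^sup>2 / (2 * c))"
  show "integrable lborel (\<lambda>r. ?M * (1 / (1 + c / 2 * r\<^sup>2)))"
    using assms by (intro integrable_mult_right integrable_inverse_quadratic) auto
  show "AE r in lborel. norm (exp (K * \<bar>r\<bar> - c * r\<^sup>2)) \<le> norm (?M * (1 / (1 + c / 2 * r\<^sup>2)))"
  proof (rule AE_I2)
    fix r :: real
    have p: "0 < 1 + c / 2 * r\<^sup>2" using assms by (auto simp: add_pos_nonneg)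
    have "0 \<le> (K / c - \<bar>r\<bar>)\<^sup>2 * (c / 2)"
      using assms by simp
    also have "\<dots> = K\<^sup>2 / (2 * c) + c / 2 * r\<^sup>2 - K * \<bar>r\<bar>"
      using assms by (simp add: field_simps power2_eq_square)
    finally have "exp (K * \<bar>r\<bar> - c * r\<^sup>2) \<le> exp (K\<^sup>2 / (2 * c) - c / 2 * r\<^sup>2)"
      by (simp add: algebra_simps)
    also have "\<dots> = ?M * inverse (exp (c / 2 * r\<^sup>2))"
      by (simp only: exp_diff divide_inverse)
    also have "\<dots> \<le> ?M * inverse (1 + c / 2 * r\<^sup>2)"
      using p by (intro mult_left_mono le_imp_inverse_le exp_ge_add_one_self) auto
    finally show "norm (exp (K * \<bar>r\<bar> - c * r\<^sup>2)) \<le> norm (?M * (1 / (1 + c / 2 * r\<^sup>2)))"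
      using p by (simp only: real_norm_def abs_of_pos exp_gt_zero mult_pos_pos zero_less_divide_1_iff divide_inverse mult_1_left positive_imp_inverse_positive)
  qed
qed simp

lemma power2_le_exp: "x\<^sup>2 \<le> exp (2 * x)" if "x \<ge> 0" for x :: real
proof -
  have "x \<le> exp x" using exp_ge_add_one_self[of x] by linarith
  then have "x\<^sup>2 \<le> (exp x)\<^sup>2" using that by (intro power_mono) auto
  then show ?thesis by (simp add: exp_double)
qed

text \<open>A second-order Taylor estimate bounds the remainder by (y - x)^2 times a fixed integral.
  Asking for every \<open>K\<close> allows the factors \<open>norm (v r)\<close> and its square,
  from the first-order term and the remainder, to be absorbed into the exponential.\<close>

lemma has_vector_derivative_integral_exp:
  fixes g v :: "'a::euclidean_space \<Rightarrow> complex"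
  assumes [measurable]: "g \<in> borel_measurable M" "v \<in> borel_measurable M"
    and int: "\<And>K. integrable M (\<lambda>r. norm (g r) * exp (K * norm (v r)))"
  shows "((\<lambda>x::real. LINT r|M. g r * exp (- (of_real x * v r))) has_vector_derivative
           (LINT r|M. - v r * g r * exp (- (of_real x * v r)))) (at x)"
proof -
  define f where "f x = (LINT r|M. g r * exp (- (of_real x * v r)))" for x :: real
  define D where "D = (LINT r|M. - v r * g r * exp (- (of_real x * v r)))"
  \<comment> \<open>The 3 collects one unit from \<open>exp \<bar>Re ?w\<bar>\<close> in the Taylor
    remainder and two from \<open>power2_le_exp\<close>; \<open>\<bar>x\<bar>\<close> comes from the
    factor \<open>exp (- (of_real x * v r))\<close>.\<close>
  define B where "B = (LINT r|M. norm (g r) * exp ((\<bar>x\<bar> + 3) * norm (v r)))"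
  have exp_le: "norm (exp (- (complex_of_real x * z))) \<le> exp (\<bar>x\<bar> * norm z)" for x z
    using complex_Re_le_cmod[of "- (complex_of_real x * z)"] by (simp add: norm_exp norm_mult)
  have int0: "integrable M (\<lambda>r. g r * exp (- (complex_of_real x * v r)))" for x
    by (rule Bochner_Integration.integrable_bound[OF int[of "\<bar>x\<bar>"]])
       (auto simp: norm_mult simp del: norm_exp_eq_Re intro!: mult_left_mono exp_le)
  have int1: "integrable M (\<lambda>r. - v r * g r * exp (- (complex_of_real x * v r)))"
  proof (rule Bochner_Integration.integrable_bound[OF int[of "\<bar>x\<bar> + 1"]])
    show "AE r in M. norm (- v r * g r * exp (- (complex_of_real x * v r)))
        \<le> norm (norm (g r) * exp ((\<bar>x\<bar> + 1) * norm (v r)))"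
    proof (rule AE_I2)
      fix r
      have "norm (v r) \<le> exp (norm (v r))" using exp_ge_add_one_self[of "norm (v r)"] by linarith
      then have "norm (g r) * (norm (v r) * norm (exp (- (complex_of_real x * v r)))) \<le>
            norm (g r) * (exp (norm (v r)) * exp (\<bar>x\<bar> * norm (v r)))"
        by (intro mult_left_mono mult_mono exp_le) auto
      also have "\<dots> = norm (g r) * exp ((\<bar>x\<bar> + 1) * norm (v r))"
        by (simp add: exp_add distrib_right)
      finally show "norm (- v r * g r * exp (- (complex_of_real x * v r)))
        \<le> norm (norm (g r) * exp ((\<bar>x\<bar> + 1) * norm (v r)))"
        by (simp add: norm_mult mult_ac)
    qed
  qed simp
  have main: "norm (f y - f x - (y - x) *\<^sub>R D) \<le> (y - x)\<^sup>2 * B" if "\<bar>y - x\<bar> \<le> 1" for y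
  proof -
    define h where "h = y - x"
    have h: "\<bar>h\<bar> \<le> 1" using that by (simp add: h_def)
    have "f y - f x - (y - x) *\<^sub>R D =
      (LINT r|M. g r * exp (- (of_real y * v r)) - g r * exp (- (of_real x * v r))
         - (y - x) *\<^sub>R (- v r * g r * exp (- (of_real x * v r))))"
      unfolding f_def D_def using int0 int1 by simp
    also have "norm \<dots> \<le> (LINT r|M. (y - x)\<^sup>2 * (norm (g r) * exp ((\<bar>x\<bar> + 3) * norm (v r))))"
    proof (rule Bochner_Integration.integral_norm_bound_integral)
      show "integrable M (\<lambda>r. g r * exp (- (of_real y * v r)) - g r * exp (- (of_real x * v r))
         - (y - x) *\<^sub>R (- v r * g r * exp (- (of_real x * v r))))"
        using int0 int1 by (intro Bochner_Integration.integrable_diff integrable_scaleR_right) auto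
      show "integrable M (\<lambda>r. (y - x)\<^sup>2 * (norm (g r) * exp ((\<bar>x\<bar> + 3) * norm (v r))))"
        by (intro integrable_mult_right int)
      fix r
      let ?w = "- (complex_of_real h * v r)"
      have "norm (exp ?w - (\<Sum>k\<le>1. ?w ^ k / fact k)) \<le> exp \<bar>Re ?w\<bar> * norm ?w ^ Suc 1 / fact 1"
        by (rule Taylor_exp)
      then have "norm (exp ?w - 1 - ?w) \<le> exp \<bar>Re ?w\<bar> * (norm ?w)\<^sup>2"
        by (simp add: numeral_2_eq_2 algebra_simps)
      also have "\<dots> \<le> exp (norm (v r)) * (h\<^sup>2 * (norm (v r))\<^sup>2)"
      proof (intro mult_mono)
        have "\<bar>Re ?w\<bar> \<le> norm ?w" by (rule abs_Re_le_cmod)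
        also have "\<dots> \<le> norm (v r)" using h by (simp add: norm_mult mult_left_le_one_le)
        finally show "exp \<bar>Re ?w\<bar> \<le> exp (norm (v r))" by simp
      qed (auto simp: norm_mult power_mult_distrib)
      also have "\<dots> \<le> exp (norm (v r)) * (h\<^sup>2 * exp (2 * norm (v r)))"
        by (intro mult_left_mono power2_le_exp) auto
      also have "\<dots> = h\<^sup>2 * exp (3 * norm (v r))"
        by (simp flip: exp_add)
      finally have 1: "norm (exp ?w - 1 - ?w) \<le> h\<^sup>2 * exp (3 * norm (v r))" .
      have "g r * exp (- (of_real y * v r)) - g r * exp (- (of_real x * v r))
         - (y - x) *\<^sub>R (- v r * g r * exp (- (of_real x * v r)))
         = g r * exp (- (of_real x * v r)) * (exp ?w - 1 - ?w)"
        by (simp add: h_def scaleR_conv_of_real algebra_simps flip: exp_add)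
      also have "norm \<dots> \<le> norm (g r) * exp (\<bar>x\<bar> * norm (v r)) * (h\<^sup>2 * exp (3 * norm (v r)))"
        unfolding norm_mult by (intro mult_mono 1 exp_le) auto
      also have "\<dots> = (y - x)\<^sup>2 * (norm (g r) * exp ((\<bar>x\<bar> + 3) * norm (v r)))"
        by (simp add: h_def distrib_right exp_add)
      finally show "norm (g r * exp (- (of_real y * v r)) - g r * exp (- (of_real x * v r))
         - (y - x) *\<^sub>R (- v r * g r * exp (- (of_real x * v r))))
         \<le> (y - x)\<^sup>2 * (norm (g r) * exp ((\<bar>x\<bar> + 3) * norm (v r)))" .
    qed
    also have "\<dots> = (y - x)\<^sup>2 * B" unfolding B_def using int by simp
    finally show ?thesis .
  qed
  have "(f has_derivative (\<lambda>h. h *\<^sub>R D)) (at x)"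
  proof (rule has_derivativeI_sandwich[of 1])
    show "norm (f y - f x - (y - x) *\<^sub>R D) / norm (y - x) \<le> \<bar>y - x\<bar> * B"
      if "y \<noteq> x" "dist y x < 1" for y
    proof -
      have "norm (f y - f x - (y - x) *\<^sub>R D) \<le> (y - x)\<^sup>2 * B"
        using that by (intro main) (auto simp: dist_real_def)
      also have "\<dots> = \<bar>y - x\<bar> * B * \<bar>y - x\<bar>"
        by (simp add: power2_eq_square mult_ac flip: abs_mult)
      finally show ?thesis
        using that by (simp add: divide_le_eq)
    qed
    have "((\<lambda>y. \<bar>y - x\<bar> * B) \<longlongrightarrow> \<bar>x - x\<bar> * B) (at x)" by (intro tendsto_intros)
    then show "((\<lambda>y. \<bar>y - x\<bar> * B) \<longlongrightarrow> 0) (at x)" by simp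
  qed (auto intro: bounded_linear_scaleR_left)
  then show ?thesis
    unfolding has_vector_derivative_def f_def D_def .
qed

section \<open>The Airy function as an integral over a vertical line\<close>

text \<open>On the line v = c + i r one has dv = i dr, so the contour integral of exp (v^3 / 3 - x
  v) / (2 pi i) is 1 / (2 pi) times the integral of this kernel over r.\<close>

definition airy_kernel :: "real \<Rightarrow> real \<Rightarrow> real \<Rightarrow> complex" where
  "airy_kernel c x r = exp (Complex c r ^ 3 / 3 - of_real x * Complex c r)"

text \<open>Re ((c + i r)^3 / 3) = c^3 / 3 - c r^2: a positive abscissa yields the Gaussian factor,
  and x enters only through exp (- c x).\<close>

lemma norm_airy_kernel: "norm (airy_kernel c x r) = exp (c ^ 3 / 3 - c * x) * exp (- c * r\<^sup>2)"
  by (simp add: airy_kernel_def norm_exp power3_eq_cube power2_eq_square field_simps flip: exp_add)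

lemma continuous_on_Complex' [continuous_intros]: "continuous_on A (Complex c)"
  unfolding Complex_eq by (intro continuous_intros)

lemma borel_measurable_Complex_right [measurable]: "Complex c \<in> borel_measurable borel"
  by (intro borel_measurable_continuous_onI continuous_intros)

lemma borel_measurable_airy_kernel [measurable]: "airy_kernel c x \<in> borel_measurable borel"
  unfolding airy_kernel_def by measurable

lemma integrable_exp_norm_Complex:
  assumes "c > 0"
  shows "integrable lborel (\<lambda>r. exp (- c * r\<^sup>2) * exp (K * norm (Complex c r)))"
proof (rule Bochner_Integration.integrable_bound)
  show "integrable lborel (\<lambda>r. exp (\<bar>K\<bar> * c) * exp (\<bar>K\<bar> * \<bar>r\<bar> - c * r\<^sup>2))"
    using assms by (intro integrable_mult_right integrable_exp_abs_minus_square)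
  show "AE r in lborel. norm (exp (- c * r\<^sup>2) * exp (K * norm (Complex c r))) \<le>
          norm (exp (\<bar>K\<bar> * c) * exp (\<bar>K\<bar> * \<bar>r\<bar> - c * r\<^sup>2))"
  proof (rule AE_I2)
    fix r
    have "K * norm (Complex c r) \<le> \<bar>K\<bar> * norm (Complex c r)"
      by (intro mult_right_mono) auto
    also have "norm (Complex c r) \<le> c + \<bar>r\<bar>"
      using cmod_le[of "Complex c r"] assms by simp
    finally have "K * norm (Complex c r) \<le> \<bar>K\<bar> * (c + \<bar>r\<bar>)"
      by (simp add: mult_left_mono)
    then show "norm (exp (- c * r\<^sup>2) * exp (K * norm (Complex c r))) \<le>
          norm (exp (\<bar>K\<bar> * c) * exp (\<bar>K\<bar> * \<bar>r\<bar> - c * r\<^sup>2))"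
      by (simp add: algebra_simps flip: exp_add)
  qed
qed simp

lemma airy_kernel_eq:
  "airy_kernel c x r = exp (Complex c r ^ 3 / 3) * exp (- (of_real x * Complex c r))"
  by (simp add: airy_kernel_def flip: exp_add)

text \<open>The exponential weight is the one demanded by
  \<open>has_vector_derivative_integral_exp\<close>; the power \<open>k\<close> is absorbed into it
  by norm v <= exp (norm v).\<close>

lemma integrable_power_airy_kernel:
  assumes "c > 0"
  shows "integrable lborel (\<lambda>r. exp (K * norm (Complex c r)) * norm (Complex c r ^ k * airy_kernel c x r))"
proof (rule Bochner_Integration.integrable_bound)
  show "integrable lborel (\<lambda>r. exp (c ^ 3 / 3 - c * x) *
          (exp (- c * r\<^sup>2) * exp ((K + real k) * norm (Complex c r))))"
    using assms by (intro integrable_mult_right integrable_exp_norm_Complex)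
  show "AE r in lborel. norm (exp (K * norm (Complex c r)) * norm (Complex c r ^ k * airy_kernel c x r)) \<le>
      norm (exp (c ^ 3 / 3 - c * x) * (exp (- c * r\<^sup>2) * exp ((K + real k) * norm (Complex c r))))"
  proof (rule AE_I2)
    fix r
    have "norm (Complex c r) \<le> exp (norm (Complex c r))"
      using exp_ge_add_one_self[of "norm (Complex c r)"] by linarith
    then have "norm (Complex c r) ^ k \<le> exp (norm (Complex c r)) ^ k"
      by (intro power_mono) auto
    also have "\<dots> = exp (real k * norm (Complex c r))"
      by (simp add: exp_of_nat_mult)
    finally have 1: "norm (Complex c r) ^ k \<le> exp (real k * norm (Complex c r))" .
    have "exp (K * norm (Complex c r)) * (norm (Complex c r) ^ k * norm (airy_kernel c x r)) \<le>
       exp (K * norm (Complex c r)) * (exp (real k * norm (Complex c r)) * norm (airy_kernel c x r))"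
      by (intro mult_left_mono mult_right_mono 1) auto
    then show "norm (exp (K * norm (Complex c r)) * norm (Complex c r ^ k * airy_kernel c x r)) \<le>
      norm (exp (c ^ 3 / 3 - c * x) * (exp (- c * r\<^sup>2) * exp ((K + real k) * norm (Complex c r))))"
      by (simp add: norm_mult norm_power norm_airy_kernel distrib_right exp_add mult_ac)
  qed
qed simp

lemma integrable_airy_kernel:
  assumes "c > 0"
  shows "integrable lborel (\<lambda>r. Complex c r ^ k * airy_kernel c x r)"
proof (rule Bochner_Integration.integrable_bound)
  show "integrable lborel (\<lambda>r. exp (0 * norm (Complex c r)) * norm (Complex c r ^ k * airy_kernel c x r))"
    using assms by (rule integrable_power_airy_kernel)
  show "(\<lambda>r. Complex c r ^ k * airy_kernel c x r) \<in> borel_measurable lborel"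
    by measurable
qed simp

lemma has_vector_derivative_airy_kernel_integral:
  assumes "c > 0"
  shows "((\<lambda>x. LINT r|lborel. Complex c r ^ k * airy_kernel c x r) has_vector_derivative
            - (LINT r|lborel. Complex c r ^ Suc k * airy_kernel c x r)) (at x)"
proof -
  have "integrable lborel (\<lambda>r. norm (Complex c r ^ k * exp (Complex c r ^ 3 / 3)) * exp (K * norm (Complex c r)))" for K
    using integrable_power_airy_kernel[OF assms, of K k 0]
    by (simp add: airy_kernel_eq mult_ac)
  from has_vector_derivative_integral_exp[OF _ _ this, of x]
  show ?thesis
    by (simp add: airy_kernel_eq mult_ac)
qed

text \<open>The r-derivative of the kernel is i (v^2 - x) times the kernel, which vanishes at both
  ends, so (v^2 - x) times the kernel integrates to zero. Two x-derivatives produce the factor v^2,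
  hence this is the Airy equation.\<close>

lemma airy_kernel_integral_ODE:
  assumes "c > 0"
  shows "(LINT r|lborel. Complex c r ^ 2 * airy_kernel c x r) = of_real x * (LINT r|lborel. airy_kernel c x r)"
proof -
  let ?f = "\<lambda>r. (Complex c r ^ 2 - of_real x) * airy_kernel c x r"
  have int: "integrable lborel ?f"
    using integrable_airy_kernel[OF assms, of 2 x] integrable_airy_kernel[OF assms, of 0 x]
    by (simp add: left_diff_distrib)
  have deriv: "(airy_kernel c x has_vector_derivative \<i> * ?f r) (at r)" for r
  proof -
    define G where "G z = exp ((of_real c + \<i> * z) ^ 3 / 3 - of_real x * (of_real c + \<i> * z))" for z
    have G: "(\<lambda>r. G (of_real r)) = airy_kernel c x"
      by (simp add: fun_eq_iff airy_kernel_def Complex_eq G_def)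
    have "(G has_field_derivative \<i> * ?f r) (at (of_real r))"
      unfolding G_def by (auto intro!: derivative_eq_intros simp: airy_kernel_def Complex_eq algebra_simps)
    from has_vector_derivative_real_field[OF this] show ?thesis
      unfolding G .
  qed
  have lim: "(airy_kernel c x \<longlongrightarrow> 0) at_top" "(airy_kernel c x \<longlongrightarrow> 0) at_bot"
  proof -
    have "((\<lambda>r. exp (c ^ 3 / 3 - c * x) * exp (- c * r\<^sup>2)) \<longlongrightarrow> 0) at_top"
      using assms by real_asymp
    moreover have "((\<lambda>r. exp (c ^ 3 / 3 - c * x) * exp (- c * r\<^sup>2)) \<longlongrightarrow> 0) at_bot"
      using assms by real_asymp
    ultimately show "(airy_kernel c x \<longlongrightarrow> 0) at_top" "(airy_kernel c x \<longlongrightarrow> 0) at_bot"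
      by (auto intro!: tendsto_norm_zero_cancel[of "airy_kernel c x"] simp: norm_airy_kernel)
  qed
  have "(LBINT r=-\<infinity>..\<infinity>. \<i> * ?f r) = 0 - 0"
  proof (rule interval_integral_FTC_integrable[where F = "airy_kernel c x"])
    show "isCont (\<lambda>r. \<i> * ?f r) r" for r
      by (simp add: airy_kernel_def Complex_eq)
    show "set_integrable lborel (einterval (-\<infinity>) \<infinity>) (\<lambda>r. \<i> * ?f r)"
      using int by (simp add: set_integrable_def einterval_eq)
    show "((airy_kernel c x \<circ> real_of_ereal) \<longlongrightarrow> 0) (at_right (-\<infinity>))"
         "((airy_kernel c x \<circ> real_of_ereal) \<longlongrightarrow> 0) (at_left \<infinity>)"
      using lim by (auto simp: ereal_tendsto_simps)
  qed (use deriv in auto)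
  then have "(LINT r|lborel. ?f r) = 0"
    by (simp add: interval_lebesgue_integral_def einterval_eq set_lebesgue_integral_def)
  then show ?thesis
    using integrable_airy_kernel[OF assms, of 2 x] integrable_airy_kernel[OF assms, of 0 x]
    by (simp add: left_diff_distrib)
qed

text \<open>Bridge between Lebesgue integrals over the whole line and the integrals over bounded
  intervals that contour arguments and the definition of \<open>Airy_Ai\<close> deal with.\<close>

lemma tendsto_integral_symmetric_interval:
  fixes f :: "real \<Rightarrow> 'a::euclidean_space"
  assumes "integrable lborel f"
  shows "((\<lambda>R. integral {- R..R} f) \<longlongrightarrow> (LINT r|lborel. f r)) at_top"
proof -
  note [measurable] = borel_measurable_integrable[OF assms]
  have "((\<lambda>R. LINT r|lborel. indicat_real {- R..R} r *\<^sub>R f r) \<longlongrightarrow> (LINT r|lborel. f r)) at_top"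
  proof (rule integral_dominated_convergence_at_top)
    show "integrable lborel (\<lambda>r. norm (f r))" using assms by simp
    show "AE r in lborel. ((\<lambda>R. indicat_real {- R..R} r *\<^sub>R f r) \<longlongrightarrow> f r) at_top"
    proof (rule AE_I2, rule tendsto_eventually)
      fix r :: real
      show "\<forall>\<^sub>F R in at_top. indicat_real {- R..R} r *\<^sub>R f r = f r"
        using eventually_ge_at_top[of "\<bar>r\<bar>"] by eventually_elim (auto simp: indicator_def)
    qed
    show "\<forall>\<^sub>F R in at_top. AE r in lborel. norm (indicat_real {- R..R} r *\<^sub>R f r) \<le> norm (f r)"
      by (auto simp: indicator_def)
  qed simp_all
  moreover have "(LINT r|lborel. indicat_real {- R..R} r *\<^sub>R f r) = integral {- R..R} f" for R
  proof -
    have "set_integrable lborel {- R..R} f"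
      using assms unfolding set_integrable_def by (intro integrable_mult_indicator) auto
    from set_borel_integral_eq_integral(2)[OF this] show ?thesis
      by (simp add: set_lebesgue_integral_def)
  qed
  ultimately show ?thesis by simp
qed

text \<open>For an odd phase the two halves of the interval carry conjugate integrands, so the sine
  parts cancel. This turns the integral along the imaginary axis into the cosine integral of
  \<open>Airy_Ai\<close>.\<close>

lemma integral_exp_imaginary_symmetric:
  fixes \<phi> :: "real \<Rightarrow> real"
  assumes "continuous_on UNIV \<phi>" "\<And>r. \<phi> (- r) = - \<phi> r" "R \<ge> 0"
  shows "integral {- R..R} (\<lambda>r. exp (\<i> * of_real (\<phi> r))) = of_real (2 * integral {0..R} (\<lambda>r. cos (\<phi> r)))"
proof -
  let ?e = "\<lambda>r. exp (\<i> * of_real (\<phi> r))"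
  have cont: "continuous_on A ?e" for A
    by (intro continuous_intros continuous_on_subset[OF assms(1)]) auto
  have cont': "continuous_on A (\<lambda>r. ?e (- r))" for A
    unfolding assms(2) by (intro continuous_intros continuous_on_subset[OF assms(1)]) auto
  have "integral {- R..R} ?e = integral {- R..0} ?e + integral {0..R} ?e"
    using assms(3) by (intro Henstock_Kurzweil_Integration.integral_combine[symmetric] integrable_continuous_real cont) auto
  also have "integral {- R..0} ?e = integral {0..R} (\<lambda>r. ?e (- r))"
    using Henstock_Kurzweil_Integration.integral_reflect_real[of R 0 "\<lambda>r. ?e (- r)"] by simp
  also have "integral {0..R} (\<lambda>r. ?e (- r)) + integral {0..R} ?e = integral {0..R} (\<lambda>r. ?e (- r) + ?e r)"
    by (intro Henstock_Kurzweil_Integration.integral_add[symmetric] integrable_continuous_real cont cont')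
  also have "(\<lambda>r. ?e (- r) + ?e r) = (\<lambda>r. of_real (2 * cos (\<phi> r)))"
    by (simp add: fun_eq_iff assms(2) cos_exp_eq flip: cos_of_real)
  also have "integral {0..R} (\<lambda>r. complex_of_real (2 * cos (\<phi> r))) = of_real (integral {0..R} (\<lambda>r. 2 * cos (\<phi> r)))"
    by (intro integral_linear[OF _ bounded_linear_of_real, unfolded o_def] integrable_continuous_real
          continuous_intros continuous_on_subset[OF assms(1)]) auto
  finally show ?thesis by simp
qed

text \<open>The contour is moved from the imaginary axis to Re v = c across rectangles of height 2
  R, whose horizontal sides contribute O(R^(-2)). The argument also shows that the limit in
  \<open>Airy_Ai\<close> exists, without which \<open>Lim\<close> would say nothing.\<close>

lemma Airy_Ai_eq_kernel_integral:
  assumes c: "c > 0"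
  shows "(LINT r|lborel. airy_kernel c x r) = of_real (2 * pi * Airy_Ai x)"
proof -
  define F where "F v = exp (v ^ 3 / 3 - of_real x * v)" for v :: complex
  define I where "I R = integral {0..R} (\<lambda>w. cos (w ^ 3 / 3 + x * w))" for R
  define L where "L = (LINT r|lborel. airy_kernel c x r)"
  define M where "M = exp (c ^ 3 / 3 + \<bar>x\<bar> * c)"
  have "F holomorphic_on UNIV" unfolding F_def by (auto intro!: holomorphic_intros)
  \<comment> \<open>With a primitive, Cauchy's theorem for the rectangle amounts to subtracting
    values of \<open>P\<close> at its corners.\<close>
  then obtain P where P: "\<And>v. (P has_field_derivative F v) (at v)"
    using holomorphic_convex_primitive'[of UNIV F] by auto
  have vert: "integral {- R..R} (\<lambda>r. F (Complex a r)) = (P (Complex a R) - P (Complex a (- R))) / \<i>"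
    if "R \<ge> 0" for a R
  proof -
    have "((\<lambda>r. \<i> * F (Complex a r)) has_integral P (Complex a R) - P (Complex a (- R))) {- R..R}"
    proof (rule fundamental_theorem_of_calculus)
      fix r
      have "((\<lambda>z. P (of_real a + \<i> * z)) has_field_derivative F (of_real a + \<i> * of_real r) * \<i>) (at (of_real r))"
        by (rule DERIV_chain'[OF _ P]) (auto intro!: derivative_eq_intros)
      from has_vector_derivative_real_field[OF this]
      show "((\<lambda>r. P (Complex a r)) has_vector_derivative \<i> * F (Complex a r)) (at r within {- R..R})"
        by (simp add: Complex_eq mult_ac has_vector_derivative_at_within)
    qed (use that in auto)
    from has_integral_mult_right[OF this, of "1 / \<i>"] show ?thesis
      by (simp add: integral_unique field_simps)
  qed
  \<comment> \<open>At v = u + i r the real part of the exponent is u^3 / 3 - x u - u r^2.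
    \<open>M\<close> bounds the exponential of the first two terms for 0 <= u <= c, and exp (- u
    r^2) integrates over u to at most 1 / r^2.\<close>
  have horiz: "norm (P (Complex c r) - P (Complex 0 r)) \<le> M / r\<^sup>2" if r: "r \<noteq> 0" for r
  proof -
    have 1: "((\<lambda>u. F (Complex u r)) has_integral P (Complex c r) - P (Complex 0 r)) {0..c}"
    proof (rule fundamental_theorem_of_calculus)
      fix u
      have "((\<lambda>z. P (z + \<i> * of_real r)) has_field_derivative F (of_real u + \<i> * of_real r) * 1) (at (of_real u))"
        by (rule DERIV_chain'[OF _ P]) (auto intro!: derivative_eq_intros)
      from has_vector_derivative_real_field[OF this]
      show "((\<lambda>u. P (Complex u r)) has_vector_derivative F (Complex u r)) (at u within {0..c})"
        by (simp add: Complex_eq has_vector_derivative_at_within)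
    qed (use c in auto)
    have 2: "((\<lambda>u. M * exp (- (u * r\<^sup>2))) has_integral - M / r\<^sup>2 * exp (- (c * r\<^sup>2)) - (- M / r\<^sup>2 * exp (- (0 * r\<^sup>2)))) {0..c}"
      using c r by (intro fundamental_theorem_of_calculus)
         (auto intro!: derivative_eq_intros simp: power2_eq_square simp flip: has_real_derivative_iff_has_vector_derivative)
    have "norm (P (Complex c r) - P (Complex 0 r)) \<le> - M / r\<^sup>2 * exp (- (c * r\<^sup>2)) - (- M / r\<^sup>2 * exp (- (0 * r\<^sup>2)))"
    proof (subst integral_unique[OF 1, symmetric], subst integral_unique[OF 2, symmetric],
           rule Henstock_Kurzweil_Integration.integral_norm_bound_integral)
      fix u assume u: "u \<in> {0..c}"
      have "- (x * u) \<le> \<bar>x\<bar> * c"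
        using u c abs_ge_minus_self[of "x * u"] mult_left_mono[of u c "\<bar>x\<bar>"] by (simp add: abs_mult)
      moreover have "u ^ 3 \<le> c ^ 3" using u by (intro power_mono) auto
      ultimately have "u ^ 3 / 3 - x * u - u * r\<^sup>2 \<le> c ^ 3 / 3 + \<bar>x\<bar> * c - u * r\<^sup>2" by simp
      moreover have "Re (Complex u r ^ 3 / 3 - of_real x * Complex u r) = u ^ 3 / 3 - x * u - u * r\<^sup>2"
        by (simp add: power3_eq_cube power2_eq_square field_simps)
      ultimately show "norm (F (Complex u r)) \<le> M * exp (- (u * r\<^sup>2))"
        unfolding F_def M_def norm_exp_eq_Re by (simp add: field_simps flip: exp_add)
    qed (use 1 2 in auto)
    also have "\<dots> \<le> M / r\<^sup>2" using M_def by simp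
    finally show ?thesis .
  qed
  \<comment> \<open>The integral along Re v = c corrected by the two horizontal sides, which is the
    integral along the imaginary axis.\<close>
  define J where "J R = integral {- R..R} (airy_kernel c x) - (P (Complex c R) - P (Complex 0 R)) / \<i>
        + (P (Complex c (- R)) - P (Complex 0 (- R))) / \<i>" for R
  have I_eq: "of_real (2 * I R) = J R" if "R \<ge> 0" for R
  proof -
    have "(\<lambda>r. F (Complex 0 r)) = (\<lambda>r. exp (\<i> * of_real (- (r ^ 3 / 3 + x * r))))"
      unfolding F_def by (rule ext, rule arg_cong[of _ _ exp]) (simp add: Complex_eq power3_eq_cube algebra_simps)
    moreover have "integral {- R..R} (\<lambda>r. exp (\<i> * of_real (- (r ^ 3 / 3 + x * r)))) =
        of_real (2 * integral {0..R} (\<lambda>r. cos (- (r ^ 3 / 3 + x * r))))"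
      by (rule integral_exp_imaginary_symmetric) (use that in \<open>auto intro!: continuous_intros simp: power3_eq_cube\<close>)
    ultimately have "integral {- R..R} (\<lambda>r. F (Complex 0 r)) =
        of_real (2 * integral {0..R} (\<lambda>r. cos (- (r ^ 3 / 3 + x * r))))" by simp
    also have "\<dots> = of_real (2 * I R)"
      unfolding I_def by (simp only: cos_minus)
    finally have "of_real (2 * I R) = integral {- R..R} (\<lambda>r. F (Complex 0 r))" by simp
    moreover have "airy_kernel c x = (\<lambda>r. F (Complex c r))"
      by (simp add: fun_eq_iff F_def airy_kernel_def)
    ultimately show ?thesis
      using vert[OF that, of 0] vert[OF that, of c] by (simp add: J_def field_simps)
  qed
  have "(J \<longlongrightarrow> L - 0 / \<i> + 0 / \<i>) at_top"
    unfolding J_def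
  proof (intro tendsto_add tendsto_diff tendsto_divide tendsto_const)
    show "((\<lambda>R. integral {- R..R} (airy_kernel c x)) \<longlongrightarrow> L) at_top"
      unfolding L_def using integrable_airy_kernel[OF c, of 0 x]
      by (intro tendsto_integral_symmetric_interval) simp
    have lim: "((\<lambda>R. M / R\<^sup>2) \<longlongrightarrow> 0) at_top" by real_asymp
    show "((\<lambda>R. P (Complex c R) - P (Complex 0 R)) \<longlongrightarrow> 0) at_top"
    proof (rule Lim_null_comparison[OF _ lim])
      show "\<forall>\<^sub>F R in at_top. norm (P (Complex c R) - P (Complex 0 R)) \<le> M / R\<^sup>2"
        using eventually_gt_at_top[of 0]
      proof eventually_elim
        case (elim R)
        then show ?case using horiz[of R] by simp
      qed
    qed
    show "((\<lambda>R. P (Complex c (- R)) - P (Complex 0 (- R))) \<longlongrightarrow> 0) at_top"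
    proof (rule Lim_null_comparison[OF _ lim])
      show "\<forall>\<^sub>F R in at_top. norm (P (Complex c (- R)) - P (Complex 0 (- R))) \<le> M / R\<^sup>2"
        using eventually_gt_at_top[of 0]
      proof eventually_elim
        case (elim R)
        then show ?case using horiz[of "- R"] by simp
      qed
    qed
  qed auto
  moreover have "\<forall>\<^sub>F R in at_top. J R = complex_of_real (2 * I R)"
    using eventually_ge_at_top[of 0] by eventually_elim (simp only: I_eq)
  ultimately have "((\<lambda>R. complex_of_real (2 * I R)) \<longlongrightarrow> L - 0 / \<i> + 0 / \<i>) at_top"
    by (rule Lim_transform_eventually)
  then have "((\<lambda>R. complex_of_real (2 * I R)) \<longlongrightarrow> L) at_top" by simp
  from tendsto_Re[OF this] tendsto_Im[OF this]
  have Re: "((\<lambda>R. 2 * I R) \<longlongrightarrow> Re L) at_top" and Im: "((\<lambda>R :: real. 0 :: real) \<longlongrightarrow> Im L) at_top"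
    by simp_all
  have "(I \<longlongrightarrow> Re L / 2) at_top"
    using tendsto_divide[OF Re tendsto_const[of 2]] by simp
  then have "Lim at_top I = Re L / 2"
    by (intro tendsto_Lim) auto
  then have "2 * pi * Airy_Ai x = Re L"
    by (simp add: Airy_Ai_def I_def[abs_def])
  moreover have "Im L = 0"
    using tendsto_unique[OF _ Im tendsto_const] by simp
  ultimately show ?thesis
    unfolding L_def by (simp add: complex_eq_iff)
qed

section \<open>The Airy equation and exponential bounds\<close>

lemma Airy_Ai_eq_Re:
  assumes "c > 0"
  shows "Airy_Ai x = Re (LINT r|lborel. airy_kernel c x r) / (2 * pi)"
  using Airy_Ai_eq_kernel_integral[OF assms, of x] by simp

lemma has_real_derivative_Airy_Ai:
  assumes "c > 0"
  shows "(Airy_Ai has_real_derivative - Re (LINT r|lborel. Complex c r * airy_kernel c x r) / (2 * pi)) (at x)"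
proof -
  have "((\<lambda>x. Re (LINT r|lborel. airy_kernel c x r)) has_vector_derivative
      Re (- (LINT r|lborel. Complex c r * airy_kernel c x r))) (at x)"
    using has_vector_derivative_airy_kernel_integral[OF assms, of 0 x]
    by (intro bounded_linear.has_vector_derivative[OF bounded_linear_Re]) simp
  then have "((\<lambda>x. Re (LINT r|lborel. airy_kernel c x r)) has_real_derivative
      - Re (LINT r|lborel. Complex c r * airy_kernel c x r)) (at x)"
    by (simp add: has_real_derivative_iff_has_vector_derivative)
  from DERIV_cdivide[OF this, of "2 * pi"] show ?thesis
    by (simp add: Airy_Ai_eq_Re[OF assms, abs_def])
qed

lemma deriv_Airy_Ai_eq:
  assumes "c > 0"
  shows "deriv Airy_Ai x = - Re (LINT r|lborel. Complex c r * airy_kernel c x r) / (2 * pi)"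
  using has_real_derivative_Airy_Ai[OF assms] by (rule DERIV_imp_deriv)

lemma DERIV_Airy_Ai: "(Airy_Ai has_real_derivative deriv Airy_Ai x) (at x)"
  using has_real_derivative_Airy_Ai[of 1 x] DERIV_imp_deriv by force

lemma DERIV_deriv_Airy_Ai: "(deriv Airy_Ai has_real_derivative x * Airy_Ai x) (at x)"
proof -
  have "((\<lambda>x. Re (LINT r|lborel. Complex 1 r * airy_kernel 1 x r)) has_vector_derivative
      Re (- (LINT r|lborel. Complex 1 r ^ 2 * airy_kernel 1 x r))) (at x)"
    using has_vector_derivative_airy_kernel_integral[of 1 1 x]
    by (intro bounded_linear.has_vector_derivative[OF bounded_linear_Re]) (simp add: power2_eq_square)
  then have "((\<lambda>x. Re (LINT r|lborel. Complex 1 r * airy_kernel 1 x r)) has_real_derivative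
      - (x * Re (LINT r|lborel. airy_kernel 1 x r))) (at x)"
    by (simp add: has_real_derivative_iff_has_vector_derivative airy_kernel_integral_ODE)
  note d = this
  have "deriv Airy_Ai = (\<lambda>x. - Re (LINT r|lborel. Complex 1 r * airy_kernel 1 x r) / (2 * pi))"
    by (simp add: fun_eq_iff deriv_Airy_Ai_eq[of 1])
  then show ?thesis
    using DERIV_cdivide[OF DERIV_minus[OF d], of "2 * pi"]
    by (simp add: Airy_Ai_eq_Re[of 1])
qed

text \<open>The modulus of the kernel depends on x only through exp (- c x), so the constant can be
  the L1 norm at x = 0, and negative x is covered as well.\<close>

lemma airy_kernel_integral_bound:
  assumes "c > 0"
  shows "\<exists>C. \<forall>x. \<bar>Re (LINT r|lborel. Complex c r ^ k * airy_kernel c x r)\<bar> \<le> C * exp (- (c * x))"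
proof (intro exI allI)
  fix x
  have e: "exp (c ^ 3 / 3 - c * x) = exp (- (c * x)) * exp (c ^ 3 / 3)"
    by (simp flip: exp_add)
  have "\<bar>Re (LINT r|lborel. Complex c r ^ k * airy_kernel c x r)\<bar> \<le>
      norm (LINT r|lborel. Complex c r ^ k * airy_kernel c x r)"
    by (rule abs_Re_le_cmod)
  also have "\<dots> \<le> (LINT r|lborel. norm (Complex c r ^ k * airy_kernel c x r))"
    by (rule integral_norm_bound)
  also have "(\<lambda>r. norm (Complex c r ^ k * airy_kernel c x r)) =
      (\<lambda>r. exp (- (c * x)) * norm (Complex c r ^ k * airy_kernel c 0 r))"
    by (simp add: fun_eq_iff norm_mult norm_airy_kernel e)
  also have "(LINT r|lborel. exp (- (c * x)) * norm (Complex c r ^ k * airy_kernel c 0 r)) =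
      (LINT r|lborel. norm (Complex c r ^ k * airy_kernel c 0 r)) * exp (- (c * x))"
    by simp
  finally show "\<bar>Re (LINT r|lborel. Complex c r ^ k * airy_kernel c x r)\<bar> \<le>
      (LINT r|lborel. norm (Complex c r ^ k * airy_kernel c 0 r)) * exp (- (c * x))" .
qed

lemma Airy_Ai_exp_bound:
  assumes "c > 0"
  obtains C where "C > 0" "\<And>x. \<bar>Airy_Ai x\<bar> \<le> C * exp (- (c * x))"
    "\<And>x. \<bar>deriv Airy_Ai x\<bar> \<le> C * exp (- (c * x))"
proof -
  obtain C0 C1 where
    C0: "\<And>x. \<bar>Re (LINT r|lborel. airy_kernel c x r)\<bar> \<le> C0 * exp (- (c * x))" and
    C1: "\<And>x. \<bar>Re (LINT r|lborel. Complex c r * airy_kernel c x r)\<bar> \<le> C1 * exp (- (c * x))"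
    using airy_kernel_integral_bound[OF assms, of 0] airy_kernel_integral_bound[OF assms, of 1] by auto
  define C where "C = 1 + \<bar>C0\<bar> + \<bar>C1\<bar>"
  have *: "\<bar>y / (2 * pi)\<bar> \<le> C * exp (- (c * x))" if "\<bar>y\<bar> \<le> D * exp (- (c * x))" "D \<le> C" for y D x
  proof -
    have "\<bar>y / (2 * pi)\<bar> \<le> \<bar>y\<bar>"
      using pi_ge_two by (simp add: divide_le_eq mult_le_cancel_left1)
    also have "\<dots> \<le> C * exp (- (c * x))"
      using that by (smt (verit, best) exp_gt_zero mult_right_mono)
    finally show ?thesis .
  qed
  show thesis
  proof
    show "C > 0" by (simp add: C_def)
    show "\<bar>Airy_Ai x\<bar> \<le> C * exp (- (c * x))" for x
      unfolding Airy_Ai_eq_Re[OF assms] by (rule *[OF C0]) (simp add: C_def)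
    show "\<bar>deriv Airy_Ai x\<bar> \<le> C * exp (- (c * x))" for x
      unfolding deriv_Airy_Ai_eq[OF assms] by (rule *[of _ C1]) (use C1 in \<open>auto simp: C_def\<close>)
  qed
qed

lemma continuous_on_Airy_Ai [continuous_intros]:
  "continuous_on A f \<Longrightarrow> continuous_on A (\<lambda>x. Airy_Ai (f x))"
  by (rule continuous_on_compose2[OF DERIV_continuous_on[of UNIV]])
     (auto intro: has_field_derivative_at_within DERIV_Airy_Ai)

lemma borel_measurable_Airy_Ai [measurable]: "Airy_Ai \<in> borel_measurable borel"
  by (intro borel_measurable_continuous_onI continuous_intros)

section \<open>The Cauchy integral formula on a half-plane\<close>

text \<open>These triangles, with base on the line Re q = c and apex c + R, exhaust the half-plane
  as R grows. Membership in the interior is what the winding number of a triangle asks for.\<close>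

lemma in_interior_triangle:
  assumes "c < Re \<zeta>" "Re \<zeta> + \<bar>Im \<zeta>\<bar> < c + R"
  shows "\<zeta> \<in> interior (convex hull {Complex c (- R), Complex c R, Complex (c + R) 0})"
proof (rule interiorI)
  let ?U = "{q. c < Re q} \<inter> {q. Re q + \<bar>Im q\<bar> < c + R}"
  show "open ?U"
    by (intro open_Int open_Collect_less continuous_intros)
  show "\<zeta> \<in> ?U" using assms by simp
  show "?U \<subseteq> convex hull {Complex c (- R), Complex c R, Complex (c + R) 0}"
  proof
    fix q assume q: "q \<in> ?U"
    \<comment> \<open>Barycentric coordinates: \<open>u\<close>, \<open>v\<close> and
      \<open>w\<close> weigh the lower base point, the upper base point and the apex.\<close>
    define w where "w = (Re q - c) / R"
    define v where "v = (R - (Re q - c) + Im q) / (2 * R)"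
    define u where "u = (R - (Re q - c) - Im q) / (2 * R)"
    have R: "R > 0" using q by auto
    have "0 \<le> u" "0 \<le> v" "0 \<le> w"
      unfolding u_def v_def w_def using q R by (intro divide_nonneg_pos; auto)+
    moreover have "u + v + w = 1"
      using R by (simp add: u_def v_def w_def field_simps)
    moreover have "w * R = Re q - c" "(v - u) * R = Im q"
      using R by (simp_all add: u_def v_def w_def field_simps)
    moreover have "u * c + v * c + w * (c + R) = (u + v + w) * c + w * R"
        "u * (- R) + v * R = (v - u) * R"
      by (simp_all add: algebra_simps)
    ultimately have "u *\<^sub>R Complex c (- R) + v *\<^sub>R Complex c R + w *\<^sub>R Complex (c + R) 0 = q"
      using \<open>u + v + w = 1\<close> by (simp add: complex_eq_iff)
    with \<open>0 \<le> u\<close> \<open>0 \<le> v\<close> \<open>0 \<le> w\<close> \<open>u + v + w = 1\<close> show "q \<in> convex hull {Complex c (- R), Complex c R, Complex (c + R) 0}"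
      unfolding convex_hull_3 by blast
  qed
qed

text \<open>Decay of order 1 / norm q makes the Cauchy integrand O((norm q)^(-2)). So the line
  integral converges absolutely, and the two slanted sides of the triangle, of length O(R),
  contribute O(1 / R).\<close>

lemma Cauchy_integral_formula_half_plane:
  fixes F :: "complex \<Rightarrow> complex"
  assumes hol: "F holomorphic_on {q. c \<le> Re q}"
    and \<zeta>: "c < Re \<zeta>"
    and decay: "\<And>q. c \<le> Re q \<Longrightarrow> R0 \<le> norm q \<Longrightarrow> norm (F q) \<le> B / norm q"
  shows "integrable lborel (\<lambda>r. F (Complex c r) / (\<zeta> - Complex c r))"
    and "(LINT r|lborel. F (Complex c r) / (\<zeta> - Complex c r)) = 2 * pi * F \<zeta>"
proof -
  let ?H = "{q. c \<le> Re q}"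
  define G where "G q = F q / (\<zeta> - q)" for q
  \<comment> \<open>From \<open>2 * norm \<zeta>\<close> on, \<open>\<zeta> - q\<close> has norm at
    least half of \<open>norm q\<close>; this is the 2 in \<open>G_bound\<close>.\<close>
  define R1 where "R1 = max (max R0 1) (2 * norm \<zeta>)"
  have R1: "R1 \<ge> R0" "R1 \<ge> 1" "R1 \<ge> 2 * norm \<zeta>" by (auto simp: R1_def)
  have B: "B \<ge> 0"
  proof -
    define q where "q = complex_of_real (max \<bar>c\<bar> R1)"
    have "0 \<le> norm (F q)" by simp
    also have "\<dots> \<le> B / norm q"
      using R1 by (intro decay) (auto simp: q_def)
    finally show ?thesis
      using R1 by (auto simp: q_def zero_le_divide_iff)
  qed
  have G_bound: "norm (G q) \<le> 2 * B / (norm q)\<^sup>2" if "c \<le> Re q" "R1 \<le> norm q" for q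
  proof -
    have q: "norm q > 0" using that R1 by linarith
    have "norm q - norm \<zeta> \<le> norm (\<zeta> - q)"
      using norm_triangle_ineq2[of q \<zeta>] by (simp add: norm_minus_commute)
    then have "norm q / 2 \<le> norm (\<zeta> - q)"
      using that R1 by linarith
    then have "norm (F q) / norm (\<zeta> - q) \<le> (B / norm q) / (norm q / 2)"
      using that R1 q B by (intro frac_le decay) auto
    then show ?thesis
      by (simp add: G_def norm_divide power2_eq_square mult_ac)
  qed
  have contF: "continuous_on ?H F" using hol by (rule holomorphic_on_imp_continuous_on)
  have contG: "continuous_on (?H - {\<zeta>}) G"
    unfolding G_def by (intro continuous_intros continuous_on_subset[OF contF]) auto
  have contG_line: "continuous_on A (\<lambda>r. G (Complex c r))" for A
    by (rule continuous_on_compose2[OF contG continuous_on_Complex']) (use \<zeta> in auto)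
  show int: "integrable lborel (\<lambda>r. F (Complex c r) / (\<zeta> - Complex c r))"
  proof -
    have "compact ((\<lambda>r. G (Complex c r)) ` {- R1..R1})"
      by (intro compact_continuous_image contG_line) simp
    then obtain K where K: "K > 0" "\<And>r. r \<in> {- R1..R1} \<Longrightarrow> norm (G (Complex c r)) \<le> K"
      using compact_imp_bounded by (force simp: bounded_pos)
    \<comment> \<open>The first entry serves the compact range; the second serves the tail, where
      r^2 >= 1 gives 1 + r^2 <= 2 r^2.\<close>
    define D where "D = max (K * (1 + R1\<^sup>2)) (4 * B)"
    have bound: "norm (G (Complex c r)) \<le> D * (1 / (1 + 1 * r\<^sup>2))" for r
    proof (cases "\<bar>r\<bar> \<le> R1")
      case True
      then have "r\<^sup>2 \<le> R1\<^sup>2" using abs_le_square_iff[of r R1] by simp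
      then have "K * (1 + r\<^sup>2) \<le> K * (1 + R1\<^sup>2)" using K by (intro mult_left_mono) auto
      then have "K * (1 + r\<^sup>2) \<le> D" by (simp add: D_def)
      then have "K \<le> D / (1 + r\<^sup>2)" by (simp add: pos_le_divide_eq add_pos_nonneg)
      with K(2)[of r] True show ?thesis by (auto simp: abs_le_iff)
    next
      case False
      have r: "r\<^sup>2 \<ge> 1" using False R1 one_le_power[of "\<bar>r\<bar>" 2] by simp
      have *: "\<bar>r\<bar> \<le> norm (Complex c r)" using abs_Im_le_cmod[of "Complex c r"] by simp
      have "norm (G (Complex c r)) \<le> 2 * B / (norm (Complex c r))\<^sup>2"
        using False * by (intro G_bound) auto
      also have "\<dots> \<le> 2 * B / r\<^sup>2"
      proof (intro divide_left_mono mult_pos_pos)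
        show "r\<^sup>2 \<le> (norm (Complex c r))\<^sup>2" using power_mono[OF *, of 2] by simp
        show "0 < (norm (Complex c r))\<^sup>2" using * False R1 by (intro zero_less_power) linarith
      qed (use B r in auto)
      also have "\<dots> \<le> 4 * B / (1 + r\<^sup>2)"
        using B r mult_left_mono[OF r, of B] by (simp add: divide_simps add_pos_nonneg algebra_simps)
      also have "\<dots> \<le> D / (1 + r\<^sup>2)"
        by (intro divide_right_mono) (auto simp: D_def)
      finally show ?thesis by simp
    qed
    show ?thesis
    proof (rule Bochner_Integration.integrable_bound)
      show "integrable lborel (\<lambda>r. D * (1 / (1 + 1 * r\<^sup>2)))"
        by (intro integrable_mult_right integrable_inverse_quadratic) auto
      show "(\<lambda>r. F (Complex c r) / (\<zeta> - Complex c r)) \<in> borel_measurable lborel"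
        using borel_measurable_continuous_onI[OF contG_line] by (simp add: G_def)
      show "AE r in lborel. norm (F (Complex c r) / (\<zeta> - Complex c r)) \<le> norm (D * (1 / (1 + 1 * r\<^sup>2)))"
        using bound by (intro AE_I2 order.trans[OF _ abs_ge_self[of "D * _", folded real_norm_def]]) (simp add: G_def)
    qed
  qed
  \<comment> \<open>The bound \<open>4 * \<bar>c\<bar>\<close> keeps the slanted sides at distance
    at least R / 4 from the origin, \<open>4 * R1\<close> then puts them where
    \<open>G_bound\<close> applies, and the last entry places \<open>\<zeta>\<close> inside the
    triangle.\<close>
  define \<rho> where "\<rho> = max (max (4 * \<bar>c\<bar>) (4 * R1)) (\<bar>Re \<zeta>\<bar> + \<bar>Im \<zeta>\<bar> + \<bar>c\<bar> + 1)"
  \<comment> \<open>Each slanted side has length at most 2 R and carries an integrand of norm at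
    most 2 B / (R / 4)^2 = 32 B / R^2, hence 64 B / R per side.\<close>
  have main: "norm (integral {- R..R} (\<lambda>r. G (Complex c r)) - 2 * pi * F \<zeta>) \<le> 128 * B / R"
    if R: "R \<ge> \<rho>" for R
  proof -
    have R': "R \<ge> 4 * \<bar>c\<bar>" "R \<ge> 4 * R1" "R \<ge> \<bar>Re \<zeta>\<bar> + \<bar>Im \<zeta>\<bar> + \<bar>c\<bar> + 1" "R > 0"
      using R R1 by (auto simp: \<rho>_def)
    define a where "a = Complex c (- R)"
    define b where "b = Complex c R"
    define d where "d = Complex (c + R) 0"
    define \<gamma> where "\<gamma> = linepath a b +++ linepath b d +++ linepath d a"
    have in_int: "\<zeta> \<in> interior (convex hull {a, b, d})"
      unfolding a_def b_def d_def using \<zeta> R' by (intro in_interior_triangle) auto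
    \<comment> \<open>Going up the line and back through the apex is clockwise. The resulting sign
      is cancelled by writing \<open>\<zeta> - q\<close> instead of \<open>q - \<zeta>\<close> in
      the denominator.\<close>
    have wn: "winding_number \<gamma> \<zeta> = -1"
      unfolding \<gamma>_def winding_number_triangle[OF in_int]
      using \<zeta> R' by (auto simp: a_def b_def mult_less_0_iff zero_less_mult_iff)
    have convH: "convex ?H" by (rule convex_halfspace_Re_ge)
    have abd: "a \<in> ?H" "b \<in> ?H" "d \<in> ?H" using R' by (auto simp: a_def b_def d_def)
    have segH: "closed_segment a b \<subseteq> ?H" "closed_segment b d \<subseteq> ?H" "closed_segment d a \<subseteq> ?H"
      using closed_segment_subset[OF _ _ convH] abd by auto
    have slanted: "norm q \<ge> R / 4 \<and> q \<noteq> \<zeta>"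
      if "q \<in> closed_segment b d \<or> q \<in> closed_segment d a" for q
    proof -
      obtain u where u: "0 \<le> u" "u \<le> 1" "Re q = c + u * R" "\<bar>Im q\<bar> = (1 - u) * R"
      proof -
        consider "q \<in> closed_segment b d" | "q \<in> closed_segment a d"
          using \<open>q \<in> closed_segment b d \<or> q \<in> closed_segment d a\<close> by (auto simp: closed_segment_commute)
        then show thesis
        proof cases
          case 1
          then obtain u where u: "0 \<le> u" "u \<le> 1" and q: "q = (1 - u) *\<^sub>R b + u *\<^sub>R d"
            by (auto simp: in_segment)
          have "Re q = c + u * R" "Im q = (1 - u) * R"
            unfolding q by (simp_all add: b_def d_def algebra_simps)
          with u R' show thesis
            by (intro that[of u]) (auto simp: abs_mult)
        next
          case 2
          then obtain u where u: "0 \<le> u" "u \<le> 1" and q: "q = (1 - u) *\<^sub>R a + u *\<^sub>R d"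
            by (auto simp: in_segment)
          have "Re q = c + u * R" "Im q = - ((1 - u) * R)"
            unfolding q by (simp_all add: a_def d_def algebra_simps)
          with u R' show thesis
            by (intro that[of u]) (auto simp: abs_mult)
        qed
      qed
      have sum: "Re q + \<bar>Im q\<bar> = c + R" using u by (simp add: algebra_simps)
      have "R \<le> \<bar>Re q\<bar> + \<bar>Im q\<bar> + \<bar>c\<bar>" using sum by linarith
      also have "\<dots> \<le> norm q + norm q + R / 4"
        using abs_Re_le_cmod[of q] abs_Im_le_cmod[of q] R' by linarith
      finally have "R / 4 \<le> norm q" using R' by linarith
      moreover have "q \<noteq> \<zeta>" using sum R' by auto
      ultimately show ?thesis by simp
    qed
    have ab: "q \<noteq> \<zeta>" if "q \<in> closed_segment a b" for q
    proof -
      from that obtain u where q: "q = (1 - u) *\<^sub>R a + u *\<^sub>R b" by (auto simp: in_segment)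
      have "Re q = c" unfolding q by (simp add: a_def b_def algebra_simps)
      then show ?thesis using \<zeta> by auto
    qed
    have off: "\<zeta> \<notin> closed_segment a b" "\<zeta> \<notin> closed_segment b d" "\<zeta> \<notin> closed_segment d a"
      using slanted[of \<zeta>] ab[of \<zeta>] by auto
    have path: "path_image \<gamma> = closed_segment a b \<union> closed_segment b d \<union> closed_segment d a"
      by (simp add: \<gamma>_def path_image_join Un_assoc)
    have "((\<lambda>w. F w / (w - \<zeta>)) has_contour_integral 2 * pi * \<i> * winding_number \<gamma> \<zeta> * F \<zeta>) \<gamma>"
    proof (rule Cauchy_integral_formula_convex_simple[OF convH hol])
      have "convex hull {a, b, d} \<subseteq> ?H" using abd convH by (intro hull_minimal) auto
      then show "\<zeta> \<in> interior ?H" using in_int interior_mono by blast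
      show "path_image \<gamma> \<subseteq> ?H - {\<zeta>}"
        unfolding path using segH off by blast
    qed (auto simp: \<gamma>_def)
    from has_contour_integral_neg[OF this]
    have "(G has_contour_integral 2 * pi * \<i> * F \<zeta>) \<gamma>"
      by (simp add: wn G_def[abs_def] divide_minus_right[symmetric] del: divide_minus_right)
    then have G\<gamma>: "contour_integral \<gamma> G = 2 * pi * \<i> * F \<zeta>"
      by (rule contour_integral_unique)
    have ci: "G contour_integrable_on linepath a b" "G contour_integrable_on linepath b d"
        "G contour_integrable_on linepath d a"
      using segH off by (intro contour_integrable_continuous_linepath continuous_on_subset[OF contG]; blast)+
    have split: "contour_integral \<gamma> G =
        contour_integral (linepath a b) G + (contour_integral (linepath b d) G + contour_integral (linepath d a) G)"
      unfolding \<gamma>_def using ci by simp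
    have vertical: "contour_integral (linepath a b) G = \<i> * integral {- R..R} (\<lambda>r. G (Complex c r))"
      using R' by (intro contour_integral_linepath_same_Re) (auto simp: a_def b_def)
    have small: "norm (G q) \<le> 32 * B / R\<^sup>2" if "q \<in> closed_segment b d \<or> q \<in> closed_segment d a" for q
    proof -
      have q: "norm q \<ge> R / 4" "c \<le> Re q" using slanted[OF that] that segH by auto
      then have "norm (G q) \<le> 2 * B / (norm q)\<^sup>2" using R' by (intro G_bound) auto
      also have "\<dots> \<le> 2 * B / (R / 4)\<^sup>2"
        using q R' B by (intro divide_left_mono power_mono mult_pos_pos zero_less_power) auto
      finally show ?thesis by (simp add: power2_eq_square)
    qed
    have len: "norm (d - b) \<le> 2 * R" "norm (a - d) \<le> 2 * R"
      using cmod_le[of "d - b"] cmod_le[of "a - d"] R' by (auto simp: a_def b_def d_def)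
    have B': "0 \<le> 32 * B / R\<^sup>2" using B by simp
    have "norm (contour_integral (linepath b d) G) \<le> 32 * B / R\<^sup>2 * norm (d - b)"
      by (rule contour_integral_bound_linepath[OF ci(2) B']) (use small in auto)
    also have "\<dots> \<le> 32 * B / R\<^sup>2 * (2 * R)" by (intro mult_left_mono len B')
    also have "\<dots> = 64 * B / R" using R' by (simp add: power2_eq_square)
    finally have 1: "norm (contour_integral (linepath b d) G) \<le> 64 * B / R" .
    have "norm (contour_integral (linepath d a) G) \<le> 32 * B / R\<^sup>2 * norm (a - d)"
      by (rule contour_integral_bound_linepath[OF ci(3) B']) (use small in auto)
    also have "\<dots> \<le> 32 * B / R\<^sup>2 * (2 * R)" by (intro mult_left_mono len B')
    also have "\<dots> = 64 * B / R" using R' by (simp add: power2_eq_square)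
    finally have 2: "norm (contour_integral (linepath d a) G) \<le> 64 * B / R" .
    have "norm (integral {- R..R} (\<lambda>r. G (Complex c r)) - 2 * pi * F \<zeta>)
        = norm (\<i> * (integral {- R..R} (\<lambda>r. G (Complex c r)) - 2 * pi * F \<zeta>))"
      by (simp add: norm_mult)
    also have "\<i> * (integral {- R..R} (\<lambda>r. G (Complex c r)) - 2 * pi * F \<zeta>)
        = - (contour_integral (linepath b d) G + contour_integral (linepath d a) G)"
      using split G\<gamma> vertical by (simp add: algebra_simps)
    also have "norm \<dots> \<le> 64 * B / R + 64 * B / R"
      unfolding norm_minus_cancel using 1 2 by (intro norm_triangle_mono)
    finally show ?thesis by simp
  qed
  have "((\<lambda>R. integral {- R..R} (\<lambda>r. G (Complex c r)) - 2 * pi * F \<zeta>) \<longlongrightarrow> 0) at_top"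
  proof (rule Lim_null_comparison)
    show "\<forall>\<^sub>F R in at_top. norm (integral {- R..R} (\<lambda>r. G (Complex c r)) - 2 * pi * F \<zeta>) \<le> 128 * B / R"
      using eventually_ge_at_top[of \<rho>] by (rule eventually_mono) (rule main)
    show "((\<lambda>R. 128 * B / R) \<longlongrightarrow> 0) at_top" by real_asymp
  qed
  then have "((\<lambda>R. integral {- R..R} (\<lambda>r. G (Complex c r))) \<longlongrightarrow> 2 * pi * F \<zeta>) at_top"
    by (rule LIM_zero_cancel)
  moreover have "((\<lambda>R. integral {- R..R} (\<lambda>r. G (Complex c r))) \<longlongrightarrow> (LINT r|lborel. G (Complex c r))) at_top"
    using int by (intro tendsto_integral_symmetric_interval) (simp add: G_def)
  ultimately show "(LINT r|lborel. F (Complex c r) / (\<zeta> - Complex c r)) = 2 * pi * F \<zeta>"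
    using tendsto_unique[OF trivial_limit_at_top_linorder] by (force simp: G_def)
qed

section \<open>The Laplace transform of the stable density\<close>

lemma borel_measurable_root [measurable]: "root n \<in> borel_measurable borel"
  by (intro borel_measurable_continuous_onI continuous_intros)

text \<open>The substitution y = (3 s)^(-1/3), which decreases from infinity to 0 with dy = - y^4
  ds. In it \<open>T_density s t\<close> ds becomes 3 t Ai(t y) dy up to orientation, and
  \<open>X3_density x s\<close> is y Ai(x y).\<close>

definition cscale :: "real \<Rightarrow> real" where
  "cscale s = 1 / root 3 (3 * s)"

lemma cscale_pos: "s > 0 \<Longrightarrow> cscale s > 0"
  by (simp add: cscale_def)

lemma cscale_cube: "s > 0 \<Longrightarrow> cscale s ^ 3 = 1 / (3 * s)"
  by (simp add: cscale_def power_divide)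

lemma borel_measurable_cscale [measurable]: "cscale \<in> borel_measurable borel"
  unfolding cscale_def[abs_def] by measurable

lemma DERIV_cscale:
  assumes "s > 0"
  shows "(cscale has_real_derivative - (cscale s ^ 4)) (at s)"
proof -
  have "((\<lambda>s. root 3 (3 * s)) has_real_derivative inverse (real 3 * root 3 (3 * s) ^ (3 - Suc 0)) * 3) (at s)"
    using assms by (intro DERIV_chain2[OF DERIV_real_root]) (auto intro!: derivative_eq_intros)
  then have 1: "((\<lambda>s. root 3 (3 * s)) has_real_derivative 1 / root 3 (3 * s) ^ 2) (at s)"
    by (simp add: field_simps numeral_2_eq_2)
  have r: "root 3 (3 * s) \<noteq> 0" using assms by simp
  have "((\<lambda>s. 1 / root 3 (3 * s)) has_real_derivative - (1 / root 3 (3 * s) ^ 4)) (at s)"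
    using r by (auto intro!: derivative_eq_intros 1 simp: field_simps power_numeral_reduce)
  then show ?thesis
    by (simp add: cscale_def[abs_def] power_divide)
qed

lemma tendsto_cscale_at_top: "(cscale \<longlongrightarrow> 0) at_top"
proof -
  have "filterlim (\<lambda>s. root 3 (3 * s)) at_top at_top"
    by (rule filterlim_compose[of "root 3" at_top at_top]) real_asymp+
  then show ?thesis unfolding cscale_def by (rule real_tendsto_divide_at_top[OF tendsto_const])
qed

lemma filterlim_cscale_at_right_0: "filterlim cscale at_top (at_right 0)"
proof -
  have "((\<lambda>s. root 3 (3 * s)) \<longlongrightarrow> root 3 (3 * 0)) (at_right 0)"
    by (intro tendsto_intros)
  moreover have "\<forall>\<^sub>F s in at_right 0. 0 < root 3 (3 * s)"
    using eventually_at_right_less[of 0] by eventually_elim simp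
  ultimately have "filterlim (\<lambda>s. inverse (root 3 (3 * s))) at_top (at_right 0)"
    by (intro filterlim_inverse_at_top) auto
  then show ?thesis by (simp add: cscale_def[abs_def] divide_inverse)
qed

lemma T_density_eq_cscale:
  assumes "s > 0"
  shows "T_density s t = 3 * t * cscale s ^ 4 * Airy_Ai (t * cscale s)"
proof -
  have "3 * cscale s ^ 4 = 3 * cscale s ^ 3 * cscale s" by (simp add: power_numeral_reduce)
  also have "\<dots> = 1 / s * cscale s" using assms by (simp add: cscale_cube)
  finally have *: "3 * cscale s ^ 4 = 1 / s * cscale s" .
  have "T_density s t = t * (1 / s * cscale s) * Airy_Ai (t * cscale s)"
    by (simp add: T_density_def cscale_def)
  also have "\<dots> = t * (3 * cscale s ^ 4) * Airy_Ai (t * cscale s)"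
    by (simp only: *)
  finally show ?thesis by (simp only: mult_ac)
qed

lemma X3_density_eq_cscale: "X3_density x s = cscale s * Airy_Ai (x * cscale s)"
  by (simp add: X3_density_def cscale_def)

lemma einterval_0_infinity: "einterval 0 \<infinity> = {0<..}"
  by (auto simp: einterval_def)

text \<open>In the variable y this is the integral of exp (- k y) over the half-line; the fourth
  power is the Jacobian.\<close>

lemma
  assumes "k > 0"
  shows set_integrable_cscale4_exp: "set_integrable lborel {0<..} (\<lambda>s. cscale s ^ 4 * exp (- (k * cscale s)))"
    and set_integral_cscale4_exp: "(LINT s:{0<..}|lborel. cscale s ^ 4 * exp (- (k * cscale s))) = 1 / k"
proof -
  let ?F = "\<lambda>s. exp (- (k * cscale s)) / k" and ?f = "\<lambda>s. cscale s ^ 4 * exp (- (k * cscale s))"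
  have F: "(?F has_real_derivative ?f s) (at s)" if "0 < ereal s" for s
    using that assms by (auto intro!: derivative_eq_intros DERIV_cscale)
  have f: "isCont ?f s" if "0 < ereal s" for s
  proof -
    have "isCont cscale s" using DERIV_cscale that by (auto intro: DERIV_isCont)
    then show ?thesis by (intro continuous_intros)
  qed
  have "((\<lambda>y. exp (- (k * y)) / k) \<longlongrightarrow> 0) at_top" using assms by real_asymp
  from filterlim_compose[OF this filterlim_cscale_at_right_0]
  have A: "((?F \<circ> real_of_ereal) \<longlongrightarrow> 0) (at_right 0)"
    by (simp add: zero_ereal_def ereal_tendsto_simps)
  have "(?F \<longlongrightarrow> exp (- (k * 0)) / k) at_top"
    using assms by (intro tendsto_intros tendsto_cscale_at_top) auto
  then have B: "((?F \<circ> real_of_ereal) \<longlongrightarrow> 1 / k) (at_left \<infinity>)"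
    by (simp add: ereal_tendsto_simps)
  have "set_integrable lborel (einterval 0 \<infinity>) ?f" "(LBINT s=0..\<infinity>. ?f s) = 1 / k - 0"
    by (rule interval_integral_FTC_nonneg[OF _ F f _ A B]; simp)+
  then show "set_integrable lborel {0<..} ?f" "(LINT s:{0<..}|lborel. ?f s) = 1 / k"
    by (simp_all only: einterval_0_infinity interval_lebesgue_integral_0_infty diff_0_right)
qed

text \<open>Majorant for the first composition, whose integrand has one power of y more than the
  Jacobian. The extra y is paid for with half of the exponent.\<close>

lemma set_integrable_cscale5_exp:
  assumes "k > 0"
  shows "set_integrable lborel {0<..} (\<lambda>s. cscale s ^ 5 * exp (- (k * cscale s)))"
proof (rule set_integrable_bound)
  show "set_integrable lborel {0<..} (\<lambda>s. 2 / k * (cscale s ^ 4 * exp (- (k / 2 * cscale s))))"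
    using assms by (intro set_integrable_mult_right set_integrable_cscale4_exp) auto
  show "set_borel_measurable lborel {0<..} (\<lambda>s. cscale s ^ 5 * exp (- (k * cscale s)))"
    unfolding set_borel_measurable_def by measurable
  show "AE s in lborel. s \<in> {0<..} \<longrightarrow> norm (cscale s ^ 5 * exp (- (k * cscale s)))
      \<le> norm (2 / k * (cscale s ^ 4 * exp (- (k / 2 * cscale s))))"
  proof (intro AE_I2 impI)
    fix s :: real assume "s \<in> {0<..}"
    then have y: "cscale s > 0" by (simp add: cscale_pos)
    have "k / 2 * cscale s \<le> exp (k / 2 * cscale s)"
      using exp_ge_add_one_self[of "k / 2 * cscale s"] by linarith
    then have "cscale s \<le> 2 / k * exp (k / 2 * cscale s)"
      using assms by (simp add: field_simps)
    then have "cscale s ^ 4 * exp (- (k * cscale s)) * cscale s \<le>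
        cscale s ^ 4 * exp (- (k * cscale s)) * (2 / k * exp (k / 2 * cscale s))"
      using y by (intro mult_left_mono) auto
    also have "\<dots> = 2 / k * (cscale s ^ 4 * (exp (- (k * cscale s)) * exp (k / 2 * cscale s)))"
      by (simp add: mult_ac)
    also have "exp (- (k * cscale s)) * exp (k / 2 * cscale s) = exp (- (k / 2 * cscale s))"
      by (simp add: algebra_simps flip: exp_add)
    finally have "cscale s ^ 5 * exp (- (k * cscale s)) \<le> 2 / k * (cscale s ^ 4 * exp (- (k / 2 * cscale s)))"
      by (simp add: power_numeral_reduce mult_ac)
    then show "norm (cscale s ^ 5 * exp (- (k * cscale s)))
      \<le> norm (2 / k * (cscale s ^ 4 * exp (- (k / 2 * cscale s))))"
      using y assms by (simp add: abs_mult)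
  qed
qed

section \<open>Laplace transform of the scaled Airy function\<close>

lemma set_integral_exp_complex:
  fixes k :: complex
  assumes "Re k > 0"
  shows "set_integrable lborel {0<..} (\<lambda>s. exp (- (k * of_real s)))"
    and "set_lebesgue_integral lborel {0<..} (\<lambda>s. exp (- (k * of_real s))) = 1 / k"
proof -
  have k: "k \<noteq> 0" using assms by auto
  show int: "set_integrable lborel {0<..} (\<lambda>s. exp (- (k * of_real s)))"
  proof (rule set_integrable_bound)
    show "set_integrable lborel {0<..} (\<lambda>s. exp (- (s * Re k)))"
      using assms by (rule integrable_I0i_exp_mscale)
    show "set_borel_measurable lborel {0<..} (\<lambda>s. exp (- (k * of_real s)))"
      unfolding set_borel_measurable_def by measurable
    show "AE s in lborel. s \<in> {0<..} \<longrightarrow> norm (exp (- (k * of_real s))) \<le> norm (exp (- (s * Re k)))"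
      by (intro AE_I2) (simp add: mult.commute)
  qed
  have "(LBINT s=0..\<infinity>. exp (- (k * of_real s))) = 0 - (- 1 / k)"
  proof (rule interval_integral_FTC_integrable[where F = "\<lambda>s. - exp (- (k * of_real s)) / k"])
    fix s :: real
    have "((\<lambda>z. - exp (- (k * z)) / k) has_field_derivative exp (- (k * of_real s))) (at (of_real s))"
      using k by (auto intro!: derivative_eq_intros)
    from has_vector_derivative_real_field[OF this]
    show "((\<lambda>s. - exp (- (k * of_real s)) / k) has_vector_derivative exp (- (k * of_real s))) (at s)" .
    show "isCont (\<lambda>s. exp (- (k * of_real s))) s" by (intro continuous_intros)
  next
    show "set_integrable lborel (einterval 0 \<infinity>) (\<lambda>s. exp (- (k * of_real s)))"
      using int by (simp only: einterval_0_infinity)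
    have "((\<lambda>s. - exp (- (k * of_real s)) / k) \<longlongrightarrow> - exp (- (k * of_real 0)) / k) (at_right 0)"
      using k by (intro tendsto_intros)
    then show "(((\<lambda>s. - exp (- (k * of_real s)) / k) \<circ> real_of_ereal) \<longlongrightarrow> - 1 / k) (at_right 0)"
      by (simp add: zero_ereal_def ereal_tendsto_simps)
    have "((\<lambda>s. exp (- (Re k * s)) / norm k) \<longlongrightarrow> 0) at_top"
      using assms k by real_asymp
    then have "((\<lambda>s. - exp (- (k * of_real s)) / k) \<longlongrightarrow> 0) at_top"
      by (intro tendsto_norm_zero_cancel[of "\<lambda>s. - exp (- (k * of_real s)) / k"]) (simp add: norm_divide)
    then show "(((\<lambda>s. - exp (- (k * of_real s)) / k) \<circ> real_of_ereal) \<longlongrightarrow> 0) (at_left \<infinity>)"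
      by (simp add: ereal_tendsto_simps)
  qed auto
  then show "set_lebesgue_integral lborel {0<..} (\<lambda>s. exp (- (k * of_real s))) = 1 / k"
    by (simp add: interval_lebesgue_integral_0_infty)
qed

text \<open>Dilating v by (3 s)^(1/3) turns v^3 / 3 into s v^3 and leaves t v free of s. The
  exponent is then linear in s and can be integrated in closed form against exp (- z s).\<close>

lemma scaled_Airy_Ai_eq_kernel_integral:
  assumes "c > 0" "s > 0"
  shows "(LINT r|lborel. exp (of_real s * Complex c r ^ 3 - of_real t * Complex c r)) =
           of_real (2 * pi * cscale s * Airy_Ai (t * cscale s))"
proof -
  define \<rho> where "\<rho> = root 3 (3 * s)"
  have \<rho>: "\<rho> > 0" "\<rho> ^ 3 = 3 * s" "cscale s = 1 / \<rho>"
    using assms by (auto simp: \<rho>_def cscale_def)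
  have eq: "airy_kernel (\<rho> * c) (t / \<rho>) (0 + \<rho> * r) = exp (of_real s * Complex c r ^ 3 - of_real t * Complex c r)" for r
  proof -
    have 1: "Complex (\<rho> * c) (0 + \<rho> * r) = of_real \<rho> * Complex c r"
      by (simp add: complex_eq_iff)
    have "complex_of_real \<rho> ^ 3 = of_real (3 * s)"
      unfolding \<rho>(2)[symmetric] by simp
    then show ?thesis
      using \<rho>(1) by (simp only: airy_kernel_def 1 power_mult_distrib) (simp add: field_simps)
  qed
  have "of_real (2 * pi * Airy_Ai (t / \<rho>)) = (LINT r|lborel. airy_kernel (\<rho> * c) (t / \<rho>) r)"
    using assms \<rho> by (subst Airy_Ai_eq_kernel_integral) auto
  also have "\<dots> = \<bar>\<rho>\<bar> *\<^sub>R (LINT r|lborel. airy_kernel (\<rho> * c) (t / \<rho>) (0 + \<rho> * r))"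
    using \<rho> by (intro lborel_integral_real_affine) auto
  finally have "of_real (1 / \<rho>) * of_real (2 * pi * Airy_Ai (t / \<rho>)) =
      of_real (1 / \<rho>) * (of_real \<rho> * (LINT r|lborel. exp (of_real s * Complex c r ^ 3 - of_real t * Complex c r)))"
    unfolding eq using \<rho>(1) by (simp add: scaleR_conv_of_real)
  also have "\<dots> = (LINT r|lborel. exp (of_real s * Complex c r ^ 3 - of_real t * Complex c r))"
    using \<rho>(1) by simp
  finally show ?thesis
    by (simp add: \<rho>(3) mult_ac)
qed

text \<open>The roots in q are \<open>\<zeta>\<close> rotated by plus and minus 120 degrees. The
  second hypothesis describes the sector |arg| <= 30 degrees, so the rotated points have nonpositive
  real part.\<close>

lemma quadratic_factor_nonzero:
  fixes q \<zeta> :: complex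
  assumes "Re q > 0" "sqrt 3 * \<bar>Im \<zeta>\<bar> \<le> Re \<zeta>"
  shows "q\<^sup>2 + q * \<zeta> + \<zeta>\<^sup>2 \<noteq> 0"
proof
  assume "q\<^sup>2 + q * \<zeta> + \<zeta>\<^sup>2 = 0"
  moreover have "(2 * q + \<zeta> - \<i> * sqrt 3 * \<zeta>) * (2 * q + \<zeta> + \<i> * sqrt 3 * \<zeta>) = 4 * (q\<^sup>2 + q * \<zeta> + \<zeta>\<^sup>2)"
    by (simp add: algebra_simps power2_eq_square flip: of_real_mult)
  ultimately have "2 * q + \<zeta> - \<i> * sqrt 3 * \<zeta> = 0 \<or> 2 * q + \<zeta> + \<i> * sqrt 3 * \<zeta> = 0"
    by simp
  then have "2 * Re q + Re \<zeta> + sqrt 3 * Im \<zeta> = 0 \<or> 2 * Re q + Re \<zeta> - sqrt 3 * Im \<zeta> = 0"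
    by (auto dest: arg_cong[of _ _ Re])
  then have "2 * Re q + Re \<zeta> \<le> sqrt 3 * \<bar>Im \<zeta>\<bar>"
    using mult_left_mono[OF abs_ge_self[of "Im \<zeta>"], of "sqrt 3"]
      mult_left_mono[OF abs_ge_minus_self[of "Im \<zeta>"], of "sqrt 3"] by auto
  with assms show False by linarith
qed

text \<open>The principal root divides an argument of size at most pi / 2 by 3. The sector is
  written without \<open>Arg\<close> to fit \<open>quadratic_factor_nonzero\<close>.\<close>

lemma cube_root_sector:
  fixes z :: complex
  assumes "z \<noteq> 0" "Re z \<ge> 0"
  defines "\<zeta> \<equiv> z powr (1 / 3)"
  shows "\<zeta> ^ 3 = z" "Re \<zeta> > 0" "sqrt 3 * \<bar>Im \<zeta>\<bar> \<le> Re \<zeta>"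
proof -
  define \<theta> where "\<theta> = Im (Ln z) / 3"
  have \<zeta>: "\<zeta> = exp (Ln z / 3)" using assms by (simp add: powr_def)
  have "exp (Ln z / 3) ^ 3 = exp (Ln z)"
    using exp_of_nat_mult[of 3 "Ln z / 3"] by simp
  then show "\<zeta> ^ 3 = z"
    unfolding \<zeta> using assms(1) by simp
  have "\<bar>Im (Ln z)\<bar> \<le> pi / 2" using Re_Ln_pos_le assms by blast
  then have \<theta>: "\<bar>\<theta>\<bar> \<le> pi / 6" by (simp add: \<theta>_def)
  have "cos (pi / 6) \<le> cos \<bar>\<theta>\<bar>" using \<theta> by (intro cos_monotone_0_pi_le) auto
  then have c: "sqrt 3 / 2 \<le> cos \<theta>" by (simp add: cos_30)
  have "sin \<theta> \<le> sin (pi / 6)" using \<theta> by (intro sin_monotone_2pi_le) auto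
  moreover have "sin (- (pi / 6)) \<le> sin \<theta>" using \<theta> by (intro sin_monotone_2pi_le) auto
  ultimately have s: "\<bar>sin \<theta>\<bar> \<le> 1 / 2" by (simp add: sin_30)
  have Re: "Re \<zeta> = exp (Re (Ln z) / 3) * cos \<theta>" and Im: "Im \<zeta> = exp (Re (Ln z) / 3) * sin \<theta>"
    by (simp_all add: \<zeta> \<theta>_def Re_exp Im_exp)
  have "0 < sqrt 3 / (2 :: real)" by simp
  then have "cos \<theta> > 0" using c by (rule less_le_trans)
  then show "Re \<zeta> > 0" unfolding Re by simp
  have "sqrt 3 * \<bar>sin \<theta>\<bar> \<le> sqrt 3 * (1 / 2)" using s by (intro mult_left_mono) auto
  also have "\<dots> \<le> cos \<theta>" using c by simp
  finally have "exp (Re (Ln z) / 3) * (sqrt 3 * \<bar>sin \<theta>\<bar>) \<le> exp (Re (Ln z) / 3) * cos \<theta>"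
    by (intro mult_left_mono) auto
  then show "sqrt 3 * \<bar>Im \<zeta>\<bar> \<le> Re \<zeta>" by (simp add: Re Im abs_mult mult_ac)
qed

lemma integrable_pairI:
  fixes f :: "real \<Rightarrow> real \<Rightarrow> 'a::{banach, second_countable_topology}"
  assumes "case_prod f \<in> borel_measurable (lborel \<Otimes>\<^sub>M lborel)"
    and "integrable lborel (\<lambda>x. LINT y|lborel. norm (f x y))"
    and "\<And>x. integrable lborel (f x)"
  shows "integrable (lborel \<Otimes>\<^sub>M lborel) (case_prod f)"
  by (rule lborel_pair.Fubini_integrable) (use assms in auto)

text \<open>Integrating over s first leaves 1 / (z - v^3), of order |v|^(-3) and with a single pole
  \<open>\<zeta>\<close> to the right of the line; 3 \<open>\<zeta>\<close>^2 is the derivative of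
  v^3 there. The case t = 0 is included because it yields the value of \<open>Ai\<close> at
  0.\<close>

lemma Laplace_scaled_Airy_Ai:
  fixes z :: complex and t :: real
  assumes z: "Re z > 0" and t: "t \<ge> 0"
  defines "\<zeta> \<equiv> z powr (1 / 3)"
  shows "set_integrable lborel {0<..} (\<lambda>s. exp (- (z * of_real s)) * of_real (cscale s * Airy_Ai (t * cscale s)))"
    and "set_lebesgue_integral lborel {0<..} (\<lambda>s. exp (- (z * of_real s)) * of_real (cscale s * Airy_Ai (t * cscale s)))
           = exp (- (of_real t * \<zeta>)) / (3 * \<zeta>\<^sup>2)"
proof -
  have "z \<noteq> 0" using z by auto
  note sector = cube_root_sector[OF this less_imp_le[OF z], folded \<zeta>_def]
  \<comment> \<open>The line must pass to the left of the pole \<open>\<zeta>\<close>, and c <= 1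
    with c < Re z gives c^3 <= c < Re z, so that the s-integral converges on the whole line.\<close>
  define c where "c = min (Re \<zeta>) (min 1 (Re z)) / 2"
  have c: "0 < c" "c < Re \<zeta>" "c < Re z" "c \<le> 1"
    using z sector(2) by (auto simp: c_def min_def)
  have "c ^ 3 \<le> c ^ 1" using c by (intro power_decreasing) auto
  then have c3: "c ^ 3 < Re z" using c by simp
  define k where "k r = z - Complex c r ^ 3" for r
  have Re_k: "Re (k r) = (Re z - c ^ 3) + 3 * c * r\<^sup>2" for r
    by (simp add: k_def power3_eq_cube power2_eq_square algebra_simps)
  have Re_k_pos: "Re (k r) > 0" for r
    unfolding Re_k using c c3 by (intro add_pos_nonneg) auto
  define g where "g r s = indicat_real {0<..} s *\<^sub>R (exp (- (k r * of_real s)) * exp (- (of_real t * Complex c r)))" for r s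
  have int_g: "integrable (lborel \<Otimes>\<^sub>M lborel) (case_prod g)"
  proof (rule integrable_pairI)
    show "case_prod g \<in> borel_measurable (lborel \<Otimes>\<^sub>M lborel)"
      unfolding g_def k_def case_prod_beta by measurable
    have "(LINT s|lborel. norm (g r s)) = exp (- (t * c)) * (1 / ((Re z - c ^ 3) + 3 * c * r\<^sup>2))" for r
    proof -
      have "(LINT s|lborel. norm (g r s)) =
          exp (- (t * c)) * (LINT s:{0<..}|lborel. exp (- (s * Re (k r))))"
        unfolding set_lebesgue_integral_def
        by (subst integral_mult_right_zero[symmetric], rule Bochner_Integration.integral_cong)
           (auto simp: g_def norm_mult indicator_def mult_ac)
      also have "(LINT s:{0<..}|lborel. exp (- (s * Re (k r)))) = 1 / Re (k r)"
        using LBINT_I0i_exp_mscale[OF Re_k_pos[of r]] by (simp add: interval_lebesgue_integral_0_infty)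
      finally show ?thesis by (simp add: Re_k)
    qed
    then show "integrable lborel (\<lambda>r. LINT s|lborel. norm (g r s))"
      using c c3 by (auto intro!: integrable_mult_right integrable_inverse_quadratic simp del: times_divide_eq_right)
    show "integrable lborel (g r)" for r
      using set_integrable_mult_left[OF set_integral_exp_complex(1)[OF Re_k_pos[of r]], of "exp (- (of_real t * Complex c r))"]
      by (simp add: set_integrable_def g_def[abs_def])
  qed
  have inner_r: "(LINT r|lborel. g r s) = 2 * pi * (indicat_real {0<..} s *\<^sub>R
      (exp (- (z * of_real s)) * of_real (cscale s * Airy_Ai (t * cscale s))))" for s
  proof (cases "s > 0")
    case True
    have "g r s = exp (- (z * of_real s)) * exp (of_real s * Complex c r ^ 3 - of_real t * Complex c r)" for r
      using True by (simp add: g_def k_def algebra_simps flip: exp_add)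
    then have "(LINT r|lborel. g r s) = exp (- (z * of_real s)) * of_real (2 * pi * cscale s * Airy_Ai (t * cscale s))"
      using scaled_Airy_Ai_eq_kernel_integral[OF c(1) True, of t] by simp
    with True show ?thesis by simp
  qed (simp add: g_def)
  have int_r: "integrable lborel (\<lambda>s. LINT r|lborel. g r s)"
    using lborel_pair.integrable_snd[OF int_g] .
  from integrable_mult_right[OF this, of "1 / (2 * pi)"]
  show "set_integrable lborel {0<..} (\<lambda>s. exp (- (z * of_real s)) * of_real (cscale s * Airy_Ai (t * cscale s)))"
    by (simp add: inner_r set_integrable_def)
  \<comment> \<open>What remains of exp (- t q) / (z - q^3) once the factor
    \<open>\<zeta> - q\<close> is split off.\<close>
  define F where "F q = exp (- (of_real t * q)) / (q\<^sup>2 + q * \<zeta> + \<zeta>\<^sup>2)" for q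
  have F_hol: "F holomorphic_on {q. c \<le> Re q}"
    unfolding F_def using c quadratic_factor_nonzero[OF _ sector(3)]
    by (intro holomorphic_intros) auto
  \<comment> \<open>For norm \<open>\<zeta>\<close> <= norm q / 2 the quadratic is at least (1 - 1/2
    - 1/4) (norm q)^2, and norm q >= 1 weakens this to norm q / 4.\<close>
  have F_decay: "norm (F q) \<le> 4 / norm q" if "c \<le> Re q" "max 1 (2 * norm \<zeta>) \<le> norm q" for q
  proof -
    have q: "norm q \<ge> 1" "norm \<zeta> \<le> norm q / 2" using that by auto
    have "norm (exp (- (of_real t * q))) \<le> 1"
      using t that c by simp
    have "norm (q * \<zeta>) \<le> norm q * (norm q / 2)"
      unfolding norm_mult using q by (intro mult_left_mono) auto
    moreover have "norm (\<zeta>\<^sup>2) \<le> (norm q / 2)\<^sup>2"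
      unfolding norm_power using q by (intro power_mono) auto
    moreover have "norm (q\<^sup>2) \<le> norm (q\<^sup>2 + q * \<zeta> + \<zeta>\<^sup>2) + norm (q * \<zeta>) + norm (\<zeta>\<^sup>2)"
    proof -
      have "q\<^sup>2 = (q\<^sup>2 + q * \<zeta> + \<zeta>\<^sup>2) - q * \<zeta> - \<zeta>\<^sup>2" by simp
      then show ?thesis by (metis (no_types) add_right_mono norm_triangle_ineq4 order_trans)
    qed
    moreover have "norm (q\<^sup>2) = (norm q)\<^sup>2" "(norm q / 2)\<^sup>2 = (norm q)\<^sup>2 / 4"
        "norm q * (norm q / 2) = (norm q)\<^sup>2 / 2"
      by (simp_all add: norm_mult power2_eq_square)
    ultimately have "(norm q)\<^sup>2 / 4 \<le> norm (q\<^sup>2 + q * \<zeta> + \<zeta>\<^sup>2)"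
      by linarith
    moreover have "norm q \<le> (norm q)\<^sup>2" using q self_le_power[of "norm q" 2] by simp
    ultimately have "norm q / 4 \<le> norm (q\<^sup>2 + q * \<zeta> + \<zeta>\<^sup>2)" by simp
    then have "norm (F q) \<le> 1 / (norm q / 4)"
      unfolding F_def norm_divide using q \<open>norm (exp (- (of_real t * q))) \<le> 1\<close>
      by (intro frac_le) auto
    then show ?thesis by simp
  qed
  have inner_s: "(LINT s|lborel. g r s) = F (Complex c r) / (\<zeta> - Complex c r)" for r
  proof -
    have "(LINT s|lborel. g r s) = exp (- (of_real t * Complex c r)) / k r"
      using set_integral_exp_complex(2)[OF Re_k_pos[of r]]
        integral_mult_left_zero[of lborel "\<lambda>s. indicat_real {0<..} s *\<^sub>R exp (- (k r * of_real s))" "exp (- (of_real t * Complex c r))"]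
      by (simp add: set_lebesgue_integral_def g_def)
    also have "k r = (\<zeta> - Complex c r) * ((Complex c r)\<^sup>2 + Complex c r * \<zeta> + \<zeta>\<^sup>2)"
      unfolding k_def sector(1)[symmetric] by (simp add: algebra_simps power2_eq_square power3_eq_cube)
    finally show ?thesis by (simp add: F_def mult.commute)
  qed
  have "(LINT r|lborel. F (Complex c r) / (\<zeta> - Complex c r)) = 2 * pi * F \<zeta>"
    by (rule Cauchy_integral_formula_half_plane(2)[OF F_hol c(2) F_decay])
  also have "F \<zeta> = exp (- (of_real t * \<zeta>)) / (3 * \<zeta>\<^sup>2)"
    by (simp add: F_def power2_eq_square)
  finally have "(LINT s|lborel. LINT r|lborel. g r s) = 2 * pi * (exp (- (of_real t * \<zeta>)) / (3 * \<zeta>\<^sup>2))"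
    unfolding lborel_pair.Fubini_integral[OF int_g] inner_s .
  then have "2 * pi * set_lebesgue_integral lborel {0<..} (\<lambda>s. exp (- (z * of_real s)) * of_real (cscale s * Airy_Ai (t * cscale s)))
           = 2 * pi * (exp (- (of_real t * \<zeta>)) / (3 * \<zeta>\<^sup>2))"
    unfolding inner_r integral_mult_right_zero set_lebesgue_integral_def .
  then show "set_lebesgue_integral lborel {0<..} (\<lambda>s. exp (- (z * of_real s)) * of_real (cscale s * Airy_Ai (t * cscale s)))
           = exp (- (of_real t * \<zeta>)) / (3 * \<zeta>\<^sup>2)"
    by (rule mult_left_cancel[THEN iffD1, rotated]) simp
qed

section \<open>Bounds and Laplace transform of the stable density\<close>

lemma borel_measurable_T_density [measurable (raw)]:
  assumes [measurable]: "f \<in> borel_measurable M" "g \<in> borel_measurable M"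
  shows "(\<lambda>x. T_density (f x) (g x)) \<in> borel_measurable M"
  unfolding T_density_def by measurable

lemma borel_measurable_X3_density [measurable (raw)]:
  assumes [measurable]: "f \<in> borel_measurable M" "g \<in> borel_measurable M"
  shows "(\<lambda>x. X3_density (f x) (g x)) \<in> borel_measurable M"
  unfolding X3_density_def by measurable

lemma T_density_bound:
  obtains C where "C > 0"
    "\<And>s t. s > 0 \<Longrightarrow> t > 0 \<Longrightarrow> \<bar>T_density s t\<bar> \<le> C * t * (cscale s ^ 4 * exp (- (t * cscale s)))"
proof -
  obtain C where C: "C > 0" "\<And>x. \<bar>Airy_Ai x\<bar> \<le> C * exp (- (1 * x))"
    by (rule Airy_Ai_exp_bound[OF zero_less_one]) (rule that)
  show thesis
  proof
    show "3 * C > 0" using C by simp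
    fix s t :: real assume s: "s > 0" and t: "t > 0"
    have "3 * t * cscale s ^ 4 * \<bar>Airy_Ai (t * cscale s)\<bar> \<le> 3 * t * cscale s ^ 4 * (C * exp (- (1 * (t * cscale s))))"
      using t by (intro mult_left_mono C) auto
    then show "\<bar>T_density s t\<bar> \<le> 3 * C * t * (cscale s ^ 4 * exp (- (t * cscale s)))"
      using s t by (simp add: T_density_eq_cscale abs_mult mult_ac)
  qed
qed

lemma set_integrable_T_density:
  assumes t: "t > 0"
  shows "set_integrable lborel {0<..} (\<lambda>s. T_density s t)"
proof -
  obtain C where C: "C > 0"
      "\<And>s t. s > 0 \<Longrightarrow> t > 0 \<Longrightarrow> \<bar>T_density s t\<bar> \<le> C * t * (cscale s ^ 4 * exp (- (t * cscale s)))"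
    by (rule T_density_bound) (rule that)
  show ?thesis
  proof (rule set_integrable_bound)
    show "set_integrable lborel {0<..} (\<lambda>s. C * t * (cscale s ^ 4 * exp (- (t * cscale s))))"
      using t by (intro set_integrable_mult_right set_integrable_cscale4_exp)
    show "set_borel_measurable lborel {0<..} (\<lambda>s. T_density s t)"
      unfolding set_borel_measurable_def by measurable
    show "AE s in lborel. s \<in> {0<..} \<longrightarrow>
        norm (T_density s t) \<le> norm (C * t * (cscale s ^ 4 * exp (- (t * cscale s))))"
      using C t by (auto intro!: AE_I2 order.trans[OF C(2)])
  qed
qed

text \<open>The factor \<open>t\<close> of \<open>T_density_bound\<close> cancels the 1 / t of
  \<open>set_integral_cscale4_exp\<close>, reflecting the scaling of the law. Uniformity in
  \<open>t\<close> lets the bound survive repeated composition.\<close>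

lemma T_density_abs_integral_bound:
  obtains C where "C > 0" "\<And>t. t > 0 \<Longrightarrow> (LINT s:{0<..}|lborel. \<bar>T_density s t\<bar>) \<le> C"
proof -
  obtain C where C: "C > 0"
      "\<And>s t. s > 0 \<Longrightarrow> t > 0 \<Longrightarrow> \<bar>T_density s t\<bar> \<le> C * t * (cscale s ^ 4 * exp (- (t * cscale s)))"
    by (rule T_density_bound) (rule that)
  show thesis
  proof
    fix t :: real assume t: "t > 0"
    have "(LINT s:{0<..}|lborel. \<bar>T_density s t\<bar>) \<le> (LINT s:{0<..}|lborel. C * t * (cscale s ^ 4 * exp (- (t * cscale s))))"
      using t C(2) set_integrable_abs[OF set_integrable_T_density[OF t]]
      by (intro set_integral_mono set_integrable_mult_right set_integrable_cscale4_exp) auto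
    also have "\<dots> = C"
      using t by (subst set_integral_mult_right) (simp add: set_integral_cscale4_exp)
    finally show "(LINT s:{0<..}|lborel. \<bar>T_density s t\<bar>) \<le> C" .
  qed (rule C(1))
qed

text \<open>
  Inserting \<open>exp (- z s) = \<integral>\<^sub>0\<^sup>\<infinity> s exp (- (z + l) s) dl\<close> turns \<open>T_density\<close> into the scaled Airy function, as
  \<open>s * T_density s t = t * cscale s * Ai (t * cscale s)\<close>. This avoids an interchange of integrals in
  \<open>Laplace_scaled_Airy_Ai\<close> that would not be absolutely convergent for \<open>T_density\<close> itself.
\<close>
lemma Laplace_T_density:
  fixes z :: complex and t :: real
  assumes z: "Re z \<ge> 0" and t: "t > 0"
  shows "set_lebesgue_integral lborel {0<..} (\<lambda>s. exp (- (z * of_real s)) * of_real (T_density s t)) =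
           exp (- (of_real t * z powr (1 / 3)))"
proof -
  define h where "h s = exp (- (z * of_real s)) * complex_of_real (T_density s t)" for s
  define g where "g s l = indicat_real {0<..} l *\<^sub>R (indicat_real {0<..} s *\<^sub>R
      (of_real s * exp (- (of_real s * of_real l)) * h s))" for s l :: real
  have int_h: "set_integrable lborel {0<..} h"
  proof (rule set_integrable_bound[OF set_integrable_T_density[OF t]])
    show "set_borel_measurable lborel {0<..} h"
      unfolding set_borel_measurable_def h_def by measurable
    show "AE s in lborel. s \<in> {0<..} \<longrightarrow> norm (h s) \<le> norm (T_density s t)"
      using z by (intro AE_I2 impI) (auto simp: h_def norm_mult intro!: mult_left_le_one_le)
  qed
  have exp_int: "set_integrable lborel {0<..} (\<lambda>l. exp (- (complex_of_real s * of_real l)))"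
      "set_lebesgue_integral lborel {0<..} (\<lambda>l. exp (- (complex_of_real s * of_real l))) = 1 / of_real s"
      if "s > 0" for s
    using set_integral_exp_complex[of "of_real s"] that by auto
  have inner_l: "(LINT l|lborel. g s l) = indicat_real {0<..} s *\<^sub>R h s" for s
  proof (cases "s > 0")
    case True
    have "(LINT l|lborel. g s l) = (LINT l|lborel. (of_real s * h s) * (indicat_real {0<..} l *\<^sub>R exp (- (complex_of_real s * of_real l))))"
      using True by (intro Bochner_Integration.integral_cong) (auto simp: g_def)
    also have "\<dots> = (of_real s * h s) * set_lebesgue_integral lborel {0<..} (\<lambda>l. exp (- (complex_of_real s * of_real l)))"
      unfolding set_lebesgue_integral_def by (rule integral_mult_right_zero)
    also have "\<dots> = h s"
      using exp_int(2)[OF True] True by simp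
    finally show ?thesis using True by simp
  qed (simp add: g_def)
  have inner_norm: "(LINT l|lborel. norm (g s l)) = indicat_real {0<..} s *\<^sub>R norm (h s)" for s
  proof (cases "s > 0")
    case True
    have "(LINT l|lborel. norm (g s l)) = (LINT l|lborel. (s * norm (h s)) * (indicat_real {0<..} l *\<^sub>R exp (- (l * s))))"
      using True by (intro Bochner_Integration.integral_cong) (auto simp: g_def norm_mult indicator_def mult_ac)
    also have "\<dots> = (s * norm (h s)) * (LINT l:{0<..}|lborel. exp (- (l * s)))"
      unfolding set_lebesgue_integral_def by (rule integral_mult_right_zero)
    also have "\<dots> = norm (h s)"
      using LBINT_I0i_exp_mscale[OF True] True by (simp add: interval_lebesgue_integral_0_infty)
    finally show ?thesis using True by simp
  qed (simp add: g_def)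
  have int_g: "integrable (lborel \<Otimes>\<^sub>M lborel) (case_prod g)"
  proof (rule integrable_pairI)
    show "case_prod g \<in> borel_measurable (lborel \<Otimes>\<^sub>M lborel)"
      unfolding g_def h_def case_prod_beta by measurable
    show "integrable lborel (\<lambda>s. LINT l|lborel. norm (g s l))"
      unfolding inner_norm using set_integrable_norm[OF int_h] by (simp add: set_integrable_def)
    show "integrable lborel (g s)" for s
    proof (cases "s > 0")
      case True
      have "g s = (\<lambda>l. (of_real s * h s) * (indicat_real {0<..} l *\<^sub>R exp (- (complex_of_real s * of_real l))))"
        using True by (auto simp: g_def fun_eq_iff)
      then show ?thesis
        using exp_int(1)[OF True] by (simp only: set_integrable_def integrable_mult_right)
    qed (simp add: g_def[abs_def])
  qed
  define \<zeta> where "\<zeta> l = (z + of_real l) powr (1 / 3)" for l :: real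
  have inner_s: "(LINT s|lborel. g s l) = indicat_real {0<..} l *\<^sub>R
      (of_real t * (exp (- (of_real t * \<zeta> l)) / (3 * (\<zeta> l)\<^sup>2)))" for l
  proof (cases "l > 0")
    case True
    have eq: "of_real s * h s * exp (- (complex_of_real s * of_real l)) = of_real t * (exp (- ((z + of_real l) * of_real s)) * of_real (cscale s * Airy_Ai (t * cscale s)))"
      if "s > 0" for s
    proof -
      have "s * T_density s t = t * (cscale s * Airy_Ai (t * cscale s))"
        using that by (simp add: T_density_def cscale_def)
      then have "complex_of_real s * of_real (T_density s t) = of_real t * of_real (cscale s * Airy_Ai (t * cscale s))"
        by (metis of_real_mult)
      moreover have "exp (- ((z + of_real l) * of_real s)) = exp (- (z * of_real s)) * exp (- (complex_of_real s * of_real l))"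
        by (simp add: algebra_simps flip: exp_add)
      ultimately show ?thesis by (simp add: h_def mult_ac)
    qed
    have "(LINT s|lborel. g s l) = (LINT s|lborel. of_real t * (indicat_real {0<..} s *\<^sub>R
       (exp (- ((z + of_real l) * of_real s)) * of_real (cscale s * Airy_Ai (t * cscale s)))))"
    proof (intro Bochner_Integration.integral_cong refl)
      fix s
      show "g s l = of_real t * (indicat_real {0<..} s *\<^sub>R
       (exp (- ((z + of_real l) * of_real s)) * of_real (cscale s * Airy_Ai (t * cscale s))))"
        using True eq[of s] by (cases "s > 0") (simp_all add: g_def mult_ac)
    qed
    also have "\<dots> = of_real t * set_lebesgue_integral lborel {0<..} (\<lambda>s.
        exp (- ((z + of_real l) * of_real s)) * of_real (cscale s * Airy_Ai (t * cscale s)))"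
      unfolding set_lebesgue_integral_def by (rule integral_mult_right_zero)
    also have "\<dots> = of_real t * (exp (- (of_real t * \<zeta> l)) / (3 * (\<zeta> l)\<^sup>2))"
      unfolding \<zeta>_def using True z t by (subst Laplace_scaled_Airy_Ai(2)) auto
    finally show ?thesis using True by simp
  qed (simp add: g_def)
  have sector: "\<zeta> l ^ 3 = z + of_real l" "Re (\<zeta> l) > 0" "sqrt 3 * \<bar>Im (\<zeta> l)\<bar> \<le> Re (\<zeta> l)" "\<zeta> l \<noteq> 0" if "l > 0" for l
  proof -
    have "z + of_real l \<noteq> 0" using z that by (auto simp: complex_eq_iff)
    from cube_root_sector[OF this] show "\<zeta> l ^ 3 = z + of_real l" "Re (\<zeta> l) > 0" "sqrt 3 * \<bar>Im (\<zeta> l)\<bar> \<le> Re (\<zeta> l)"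
      using z that by (auto simp: \<zeta>_def)
    then show "\<zeta> l \<noteq> 0" by auto
  qed
  have "(LINT l|lborel. LINT s|lborel. g s l) = (LBINT l=0..\<infinity>. of_real t * (exp (- (of_real t * \<zeta> l)) / (3 * (\<zeta> l)\<^sup>2)))"
    unfolding inner_s by (simp add: interval_lebesgue_integral_0_infty set_lebesgue_integral_def)
  \<comment> \<open>Differentiating \<open>\<zeta> l ^ 3 = z + of_real l\<close> gives the
    derivative 1 / (3 \<open>\<zeta>\<close>^2), so the integrand is the exact derivative of - exp
    (- t \<open>\<zeta>\<close>).\<close>
  also have "\<dots> = 0 - (- exp (- (of_real t * z powr (1 / 3))))"
  proof (rule interval_integral_FTC_integrable[where F = "\<lambda>l. - exp (- (of_real t * \<zeta> l))"])
    fix l :: real assume "0 < ereal l"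
    then have l: "l > 0" by simp
    have nonneg: "z + of_real l \<notin> \<real>\<^sub>\<le>\<^sub>0"
      using z l by (auto simp: complex_nonpos_Reals_iff)
    have d: "((\<lambda>w. (z + w) powr (1 / 3)) has_field_derivative 1 / (3 * (\<zeta> l)\<^sup>2)) (at (of_real l))"
    proof -
      have "(z + of_real l) powr (1 / 3 - 1) = \<zeta> l / (z + of_real l)"
        unfolding powr_diff \<zeta>_def by simp
      also have "\<dots> = \<zeta> l / \<zeta> l ^ 3"
        by (simp only: sector(1)[OF l])
      also have "\<dots> = 1 / (\<zeta> l)\<^sup>2"
        using sector(4)[OF l] by (simp add: power2_eq_square power3_eq_cube)
      finally have "1 / 3 * (z + of_real l) powr (1 / 3 - 1) = 1 / (3 * (\<zeta> l)\<^sup>2)" by simp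
      then show ?thesis
        using nonneg by (auto intro!: derivative_eq_intros)
    qed
    have "((\<lambda>w. - exp (- (of_real t * (z + w) powr (1 / 3)))) has_field_derivative
        of_real t * (exp (- (of_real t * \<zeta> l)) / (3 * (\<zeta> l)\<^sup>2))) (at (of_real l))"
      using DERIV_minus[OF DERIV_chain2[OF DERIV_exp DERIV_minus[OF DERIV_cmult[OF d, of "of_real t"]]]]
      by (simp add: \<zeta>_def mult_ac)
    from has_vector_derivative_real_field[OF this]
    show "((\<lambda>l. - exp (- (of_real t * \<zeta> l))) has_vector_derivative
        of_real t * (exp (- (of_real t * \<zeta> l)) / (3 * (\<zeta> l)\<^sup>2))) (at l)"
      by (simp add: \<zeta>_def)
    have "isCont \<zeta> l"
      unfolding \<zeta>_def[abs_def] isCont_def using nonneg by (intro tendsto_intros) auto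
    then show "isCont (\<lambda>l. of_real t * (exp (- (of_real t * \<zeta> l)) / (3 * (\<zeta> l)\<^sup>2))) l"
      using sector(4)[OF l] by (intro continuous_intros) auto
  next
    show "set_integrable lborel (einterval 0 \<infinity>) (\<lambda>l. of_real t * (exp (- (of_real t * \<zeta> l)) / (3 * (\<zeta> l)\<^sup>2)))"
      using lborel_pair.integrable_snd[OF int_g] unfolding inner_s
      by (simp add: set_integrable_def einterval_0_infinity)
    have "((\<lambda>l. z + complex_of_real l) \<longlongrightarrow> z + of_real 0) (at_right 0)"
      by (intro tendsto_intros)
    \<comment> \<open>In the closed right half-plane only z = 0 meets the branch cut, and there the
      power is continuous because its exponent has positive real part.\<close>
    moreover have "z \<notin> \<real>\<^sub>\<le>\<^sub>0 \<or> z = 0 \<and> Re (1 / 3) > 0"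
      using z by (auto simp: complex_nonpos_Reals_iff complex_eq_iff)
    ultimately have "(\<zeta> \<longlongrightarrow> z powr (1 / 3)) (at_right 0)"
      unfolding \<zeta>_def[abs_def] by (intro tendsto_powr_complex') auto
    then have "((\<lambda>l. - exp (- (of_real t * \<zeta> l))) \<longlongrightarrow> - exp (- (of_real t * z powr (1 / 3)))) (at_right 0)"
      by (intro tendsto_intros)
    then show "(((\<lambda>l. - exp (- (of_real t * \<zeta> l))) \<circ> real_of_ereal) \<longlongrightarrow> - exp (- (of_real t * z powr (1 / 3)))) (at_right 0)"
      by (simp add: zero_ereal_def ereal_tendsto_simps)
    have "((\<lambda>l. - exp (- (of_real t * \<zeta> l))) \<longlongrightarrow> 0) at_top"
    proof (rule Lim_null_comparison)
      show "((\<lambda>l. exp (- (t * (l powr (1 / 3) / 2)))) \<longlongrightarrow> 0) at_top"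
        using t by real_asymp
      show "\<forall>\<^sub>F l in at_top. norm (- exp (- (of_real t * \<zeta> l))) \<le> exp (- (t * (l powr (1 / 3) / 2)))"
        using eventually_gt_at_top[of 0]
      proof eventually_elim
        case (elim l)
        \<comment> \<open>In the sector the imaginary part is dominated by the real part, so Re
          \<open>\<zeta>\<close> is at least half of norm \<open>\<zeta>\<close> and tends to
          infinity with l.\<close>
        have "1 * \<bar>Im (\<zeta> l)\<bar> \<le> sqrt 3 * \<bar>Im (\<zeta> l)\<bar>"
          by (intro mult_right_mono) auto
        then have "norm (\<zeta> l) \<le> 2 * Re (\<zeta> l)"
          using cmod_le[of "\<zeta> l"] sector(2,3)[OF elim] by simp
        moreover have "l powr (1 / 3) \<le> norm (z + of_real l) powr (1 / 3)"
          using complex_Re_le_cmod[of "z + of_real l"] z elim by (intro powr_mono2) auto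
        moreover have "norm (\<zeta> l) = norm (z + of_real l) powr (1 / 3)"
          unfolding \<zeta>_def by (subst norm_powr_real_powr') auto
        ultimately have "l powr (1 / 3) / 2 \<le> Re (\<zeta> l)" by linarith
        then show ?case using t by (simp add: mult_left_mono)
      qed
    qed
    then show "(((\<lambda>l. - exp (- (of_real t * \<zeta> l))) \<circ> real_of_ereal) \<longlongrightarrow> 0) (at_left \<infinity>)"
      by (simp add: ereal_tendsto_simps)
  qed auto
  finally show ?thesis
    unfolding lborel_pair.Fubini_integral[OF int_g] inner_l
    by (simp add: set_lebesgue_integral_def h_def)
qed

section \<open>The values at the origin\<close>

lemma set_integral_Gamma_real:
  fixes a :: real
  assumes "a > 0"
  shows "set_integrable lborel {0<..} (\<lambda>s. s powr (a - 1) * exp (- s))"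
    and "(LINT s:{0<..}|lborel. s powr (a - 1) * exp (- s)) = Gamma a"
proof -
  let ?f = "\<lambda>s::real. indicator {0..} s * s powr (a - 1) / exp s"
  have eq: "(\<lambda>s. indicat_real {0<..} s *\<^sub>R (s powr (a - 1) * exp (- s))) = ?f"
    by (auto simp: fun_eq_iff indicator_def exp_minus field_simps)
  have nn: "(\<integral>\<^sup>+ s. ennreal (?f s) \<partial>lborel) = ennreal (Gamma a)"
    using Gamma_conv_nn_integral_real[OF assms] by simp
  have int: "integrable lborel ?f"
    by (rule integrableI_nn_integral_finite[OF _ _ nn]) auto
  then show "set_integrable lborel {0<..} (\<lambda>s. s powr (a - 1) * exp (- s))"
    unfolding set_integrable_def eq .
  have "integral\<^sup>L lborel ?f = enn2real (\<integral>\<^sup>+ s. ennreal (?f s) \<partial>lborel)"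
    by (rule integral_eq_nn_integral) auto
  also have "\<dots> = Gamma a"
    unfolding nn using assms by (simp add: Gamma_real_pos less_imp_le)
  finally show "(LINT s:{0<..}|lborel. s powr (a - 1) * exp (- s)) = Gamma a"
    unfolding set_lebesgue_integral_def eq .
qed

lemma Gamma_one_third_two_thirds: "Gamma (1 / 3) * Gamma (2 / 3 :: real) = 2 * pi / sqrt 3"
proof -
  have "Gamma (complex_of_real (1 / 3)) * Gamma (1 - complex_of_real (1 / 3)) =
      of_real pi / sin (of_real pi * complex_of_real (1 / 3))"
    by (rule Gamma_reflection_complex)
  also have "1 - complex_of_real (1 / 3) = of_real (2 / 3)" by simp
  also have "of_real pi * complex_of_real (1 / 3) = of_real (pi / 3)" by simp
  finally have "complex_of_real (Gamma (1 / 3) * Gamma (2 / 3)) = of_real (pi / sin (pi / 3))"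
    by (simp only: Gamma_complex_of_real sin_of_real flip: of_real_mult of_real_divide)
  then have "Gamma (1 / 3) * Gamma (2 / 3) = pi / sin (pi / 3)"
    by (simp only: of_real_eq_iff)
  then show ?thesis by (simp add: sin_60 mult.commute)
qed

lemma cscale_eq_powr: "s > 0 \<Longrightarrow> cscale s = 3 powr (- 1 / 3) * s powr (- 1 / 3)"
  by (simp add: cscale_def root_powr_inverse powr_mult powr_minus_divide)

text \<open>The weight y^a = (3 s)^(-a/3) makes this a Gamma integral with parameter 1 - a / 3,
  positive exactly when a < 3.\<close>

lemma set_integral_cscale_power_exp:
  assumes "a < 3"
  shows "set_integrable lborel {0<..} (\<lambda>s. exp (- s) * cscale s ^ a)"
    and "(LINT s:{0<..}|lborel. exp (- s) * cscale s ^ a) = 3 powr (- real a / 3) * Gamma (1 - real a / 3)"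
proof -
  have eq: "exp (- s) * cscale s ^ a = 3 powr (- real a / 3) * (s powr (1 - real a / 3 - 1) * exp (- s))"
    if "s \<in> {0<..}" for s
    using that by (simp add: cscale_eq_powr power_mult_distrib powr_powr flip: powr_realpow)
  have pos: "1 - real a / 3 > 0" using assms by simp
  show "set_integrable lborel {0<..} (\<lambda>s. exp (- s) * cscale s ^ a)"
    using set_integrable_mult_right[OF set_integral_Gamma_real(1)[OF pos], of "3 powr (- real a / 3)"]
    by (rule set_integrable_cong[THEN iffD1, rotated -1]) (use eq in auto)
  have "(LINT s:{0<..}|lborel. exp (- s) * cscale s ^ a) =
      (LINT s:{0<..}|lborel. 3 powr (- real a / 3) * (s powr (1 - real a / 3 - 1) * exp (- s)))"
    by (rule set_lebesgue_integral_cong) (use eq in auto)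
  also have "\<dots> = 3 powr (- real a / 3) * Gamma (1 - real a / 3)"
    by (subst set_integral_mult_right) (simp only: set_integral_Gamma_real(2)[OF pos])
  finally show "(LINT s:{0<..}|lborel. exp (- s) * cscale s ^ a) = 3 powr (- real a / 3) * Gamma (1 - real a / 3)" .
qed

lemma Laplace_scaled_Airy_Ai_at_1:
  assumes "t \<ge> 0"
  shows "set_integrable lborel {0<..} (\<lambda>s. exp (- s) * (cscale s * Airy_Ai (t * cscale s)))"
    and "(LINT s:{0<..}|lborel. exp (- s) * (cscale s * Airy_Ai (t * cscale s))) = exp (- t) / 3"
proof -
  have eq: "exp (- (1 * complex_of_real s)) * of_real (cscale s * Airy_Ai (t * cscale s)) =
      complex_of_real (exp (- s) * (cscale s * Airy_Ai (t * cscale s)))" for s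
    by (simp add: exp_of_real[symmetric])
  note L = Laplace_scaled_Airy_Ai[of 1 t, unfolded eq]
  have "integrable lborel (\<lambda>s. complex_of_real (indicat_real {0<..} s *\<^sub>R (exp (- s) * (cscale s * Airy_Ai (t * cscale s)))))"
    using L(1) assms by (simp add: set_integrable_def scaleR_conv_of_real)
  then show "set_integrable lborel {0<..} (\<lambda>s. exp (- s) * (cscale s * Airy_Ai (t * cscale s)))"
    unfolding set_integrable_def complex_of_real_integrable_eq .
  have "complex_of_real (LINT s:{0<..}|lborel. exp (- s) * (cscale s * Airy_Ai (t * cscale s))) = of_real (exp (- t) / 3)"
    using L(2) assms by (simp add: set_integral_complex_of_real exp_of_real[symmetric] del: of_real_mult)
  then show "(LINT s:{0<..}|lborel. exp (- s) * (cscale s * Airy_Ai (t * cscale s))) = exp (- t) / 3"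
    by (simp only: of_real_eq_iff)
qed

text \<open>At t = 0 the Airy factor in the Laplace transform is constant and leaves a Gamma
  integral.\<close>

lemma Airy_Ai_0: "Airy_Ai 0 * (3 powr (- 1 / 3) * Gamma (2 / 3)) = 1 / 3"
proof -
  have "(LINT s:{0<..}|lborel. exp (- s) * (cscale s * Airy_Ai (0 * cscale s))) = 1 / 3"
    using Laplace_scaled_Airy_Ai_at_1(2)[of 0] by simp
  also have "(LINT s:{0<..}|lborel. exp (- s) * (cscale s * Airy_Ai (0 * cscale s))) =
      (LINT s:{0<..}|lborel. Airy_Ai 0 * (exp (- s) * cscale s ^ 1))"
    by (simp add: mult_ac)
  also have "\<dots> = Airy_Ai 0 * (3 powr (- real 1 / 3) * Gamma (1 - real 1 / 3))"
    by (subst set_integral_mult_right) (simp only: set_integral_cscale_power_exp(2)[of 1])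
  finally show ?thesis by simp
qed

text \<open>This is the t-derivative at 0 of \<open>Laplace_scaled_Airy_Ai_at_1\<close>: the left
  side acquires a second factor y, the right side becomes - 1 / 3.\<close>

lemma deriv_Airy_Ai_0: "deriv Airy_Ai 0 * (3 powr (- 2 / 3) * Gamma (1 / 3)) = - 1 / 3"
proof -
  obtain C where C: "C > 0" "\<And>x. \<bar>deriv Airy_Ai x\<bar> \<le> C * exp (- (1 * x))"
    by (rule Airy_Ai_exp_bound[OF zero_less_one]) (rule that)
  \<comment> \<open>Provides the dominating function C y^2 exp (- s) for the difference
    quotients.\<close>
  have lip: "\<bar>Airy_Ai u - Airy_Ai 0\<bar> \<le> C * u" if u: "u > 0" for u
  proof -
    obtain v where v: "0 < v" "v < u" "Airy_Ai u - Airy_Ai 0 = (u - 0) * deriv Airy_Ai v"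
      using MVT2[OF u, of Airy_Ai "deriv Airy_Ai"] DERIV_Airy_Ai by blast
    have "\<bar>deriv Airy_Ai v\<bar> \<le> C * exp (- (1 * v))" by (rule C)
    also have "\<dots> \<le> C * 1" using C(1) v by (intro mult_left_mono) auto
    finally have "u * \<bar>deriv Airy_Ai v\<bar> \<le> u * C" using u by (intro mult_left_mono) auto
    then show ?thesis using v u by (simp add: abs_mult mult.commute)
  qed
  define \<tau> where "\<tau> n = 1 / real (Suc n)" for n
  have \<tau>: "\<tau> n > 0" for n by (simp add: \<tau>_def)
  \<comment> \<open>Difference quotient in t, between 0 and \<open>\<tau> n\<close>, of the Laplace
    integrand.\<close>
  define f where "f n s = exp (- s) * (cscale s * ((Airy_Ai (\<tau> n * cscale s) - Airy_Ai 0) / \<tau> n))" for n s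
  have f_int: "(LINT s:{0<..}|lborel. f n s) = (exp (- \<tau> n) - 1) / \<tau> n / 3" for n
  proof -
    have "(LINT s:{0<..}|lborel. f n s) = (LINT s:{0<..}|lborel. 1 / \<tau> n *
        (exp (- s) * (cscale s * Airy_Ai (\<tau> n * cscale s)) - exp (- s) * (cscale s * Airy_Ai (0 * cscale s))))"
      by (simp add: f_def right_diff_distrib diff_divide_distrib)
    also have "\<dots> = 1 / \<tau> n * (exp (- \<tau> n) / 3 - exp (- 0) / 3)"
      using less_imp_le[OF \<tau>]
      by (simp only: set_integral_mult_right set_integral_diff(2) Laplace_scaled_Airy_Ai_at_1 order_refl)
    finally show ?thesis by (simp add: field_simps)
  qed
  have "(\<lambda>n. LINT s:{0<..}|lborel. f n s) \<longlonglongrightarrow> (LINT s:{0<..}|lborel. deriv Airy_Ai 0 * (exp (- s) * cscale s ^ 2))"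
    unfolding set_lebesgue_integral_def
  proof (rule integral_dominated_convergence)
    show "integrable lborel (\<lambda>s. indicat_real {0<..} s *\<^sub>R (C * (exp (- s) * cscale s ^ 2)))"
      using set_integrable_mult_right[OF set_integral_cscale_power_exp(1)[of 2], of C]
      by (simp add: set_integrable_def)
    show "(\<lambda>s. indicat_real {0<..} s *\<^sub>R f n s) \<in> borel_measurable lborel" for n
      unfolding f_def by measurable
    show "AE s in lborel. norm (indicat_real {0<..} s *\<^sub>R f n s) \<le> indicat_real {0<..} s *\<^sub>R (C * (exp (- s) * cscale s ^ 2))" for n
    proof (rule AE_I2)
      fix s :: real
      show "norm (indicat_real {0<..} s *\<^sub>R f n s) \<le> indicat_real {0<..} s *\<^sub>R (C * (exp (- s) * cscale s ^ 2))"
      proof (cases "s > 0")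
        case True
        have y: "cscale s > 0" using True by (rule cscale_pos)
        have "\<bar>Airy_Ai (\<tau> n * cscale s) - Airy_Ai 0\<bar> \<le> C * (\<tau> n * cscale s)"
          using y \<tau>[of n] by (intro lip) simp
        then have "\<bar>Airy_Ai (\<tau> n * cscale s) - Airy_Ai 0\<bar> / \<tau> n \<le> C * cscale s"
          using \<tau>[of n] by (simp add: field_simps)
        then have "exp (- s) * (cscale s * (\<bar>Airy_Ai (\<tau> n * cscale s) - Airy_Ai 0\<bar> / \<tau> n)) \<le> exp (- s) * (cscale s * (C * cscale s))"
          using y by (intro mult_left_mono) auto
        then show ?thesis
          using True y \<tau>[of n] by (simp add: f_def abs_mult power2_eq_square mult_ac)
      qed simp
    qed
    show "AE s in lborel. (\<lambda>n. indicat_real {0<..} s *\<^sub>R f n s) \<longlonglongrightarrow>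
        indicat_real {0<..} s *\<^sub>R (deriv Airy_Ai 0 * (exp (- s) * cscale s ^ 2))"
    proof (rule AE_I2)
      fix s :: real
      show "(\<lambda>n. indicat_real {0<..} s *\<^sub>R f n s) \<longlonglongrightarrow>
        indicat_real {0<..} s *\<^sub>R (deriv Airy_Ai 0 * (exp (- s) * cscale s ^ 2))"
      proof (cases "s > 0")
        case True
        have y: "cscale s > 0" using True by (rule cscale_pos)
        have "((\<lambda>h. (Airy_Ai (0 + h) - Airy_Ai 0) / h) \<longlongrightarrow> deriv Airy_Ai 0) (at 0)"
          using DERIV_Airy_Ai[of 0] by (simp add: DERIV_def)
        moreover have "filterlim (\<lambda>n. \<tau> n * cscale s) (at 0) sequentially"
        proof (rule filterlim_atI)
          have "\<tau> \<longlonglongrightarrow> 0" unfolding \<tau>_def[abs_def] by real_asymp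
          from tendsto_mult_left_zero[OF this] show "(\<lambda>n. \<tau> n * cscale s) \<longlonglongrightarrow> 0" .
          show "\<forall>\<^sub>F n in sequentially. \<tau> n * cscale s \<noteq> 0"
            using y \<tau> by (intro always_eventually) (auto simp: less_imp_neq[symmetric])
        qed
        ultimately have "(\<lambda>n. (Airy_Ai (0 + \<tau> n * cscale s) - Airy_Ai 0) / (\<tau> n * cscale s)) \<longlonglongrightarrow> deriv Airy_Ai 0"
          by (rule filterlim_compose)
        then have "(\<lambda>n. exp (- s) * cscale s ^ 2 * ((Airy_Ai (0 + \<tau> n * cscale s) - Airy_Ai 0) / (\<tau> n * cscale s)))
            \<longlonglongrightarrow> exp (- s) * cscale s ^ 2 * deriv Airy_Ai 0"
          by (intro tendsto_intros)
        also have "(\<lambda>n. exp (- s) * cscale s ^ 2 * ((Airy_Ai (0 + \<tau> n * cscale s) - Airy_Ai 0) / (\<tau> n * cscale s))) = (\<lambda>n. f n s)"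
          using y by (simp add: f_def fun_eq_iff power2_eq_square)
        finally show ?thesis using True by (simp add: mult_ac)
      qed simp
    qed
  qed simp
  moreover have "(\<lambda>n. LINT s:{0<..}|lborel. f n s) \<longlonglongrightarrow> - 1 / 3"
    unfolding f_int \<tau>_def by real_asymp
  ultimately have "(LINT s:{0<..}|lborel. deriv Airy_Ai 0 * (exp (- s) * cscale s ^ 2)) = - 1 / 3"
    by (rule LIMSEQ_unique)
  also have "(LINT s:{0<..}|lborel. deriv Airy_Ai 0 * (exp (- s) * cscale s ^ 2)) =
      deriv Airy_Ai 0 * (3 powr (- real 2 / 3) * Gamma (1 - real 2 / 3))"
    by (subst set_integral_mult_right) (simp add: set_integral_cscale_power_exp(2)[of 2])
  finally show ?thesis by simp
qed

text \<open>Only the product occurs in the Wronskian at 0, and in it the two Gamma values combine by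
  the reflection formula.\<close>

lemma Airy_Ai_0_times_deriv: "Airy_Ai 0 * deriv Airy_Ai 0 = - 1 / (2 * pi * sqrt 3)"
proof -
  have "3 powr (- 1 / 3) * 3 powr (- 2 / 3) = (1 / 3 :: real)"
    by (simp add: powr_minus_divide flip: powr_add)
  moreover have "(Airy_Ai 0 * deriv Airy_Ai 0) * (3 powr (- 1 / 3) * 3 powr (- 2 / 3) * (Gamma (1 / 3) * Gamma (2 / 3))) = 1 / 3 * (- 1 / 3)"
  proof -
    have "(Airy_Ai 0 * deriv Airy_Ai 0) * (3 powr (- 1 / 3) * 3 powr (- 2 / 3) * (Gamma (1 / 3) * Gamma (2 / 3))) =
        (Airy_Ai 0 * (3 powr (- 1 / 3) * Gamma (2 / 3))) * (deriv Airy_Ai 0 * (3 powr (- 2 / 3) * Gamma (1 / 3)))"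
      by (simp only: mult_ac)
    then show ?thesis by (simp only: Airy_Ai_0 deriv_Airy_Ai_0)
  qed
  ultimately have "(Airy_Ai 0 * deriv Airy_Ai 0) * (1 / 3 * (2 * pi / sqrt 3)) = 1 / 3 * (- 1 / 3)"
    by (simp only: Gamma_one_third_two_thirds)
  then have "Airy_Ai 0 * deriv Airy_Ai 0 * (2 * pi) = - (sqrt 3 / 3)"
    by (simp add: field_simps)
  also have "sqrt 3 / 3 = 1 / sqrt 3"
    by (simp add: field_simps)
  finally show ?thesis by (simp add: field_simps)
qed

section \<open>The law of the first composition\<close>

text \<open>The Cauchy density with location - t / 2 and scale sqrt 3 t / 2.\<close>

definition Z1_density :: "real \<Rightarrow> real \<Rightarrow> real" where
  "Z1_density x t = sqrt 3 / (2 * pi) * (t / (t\<^sup>2 + t * x + x\<^sup>2))"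

lemma quadratic_form_pos:
  fixes t x :: real
  assumes "t > 0"
  shows "t\<^sup>2 + t * x + x\<^sup>2 > 0"
proof -
  have "t\<^sup>2 + t * x + x\<^sup>2 = (x + t / 2)\<^sup>2 + 3 / 4 * t\<^sup>2"
    by (simp add: power2_eq_square field_simps)
  also have "\<dots> > 0" using assms by (intro add_nonneg_pos) auto
  finally show ?thesis .
qed

lemma Z1_density_nonneg: "t > 0 \<Longrightarrow> Z1_density x t \<ge> 0"
  using quadratic_form_pos[of t x] by (simp add: Z1_density_def)

text \<open>
  In the variable \<open>y = cscale s\<close> the integrand is a constant multiple of the derivative of the
  Wronskian \<open>W\<close> of \<open>Ai (x y)\<close> and \<open>Ai (t y)\<close>.
\<close>
lemma Z_density_1:
  assumes t: "t > 0" and x: "x \<noteq> t"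
  shows "Z_density 1 x t = Z1_density x t"
proof -
  define q where "q = t\<^sup>2 + t * x + x\<^sup>2"
  have q: "q > 0" using quadratic_form_pos[OF t, of x] by (simp add: q_def)
  have cubes: "t ^ 3 - x ^ 3 = (t - x) * q"
    by (simp add: q_def power2_eq_square power3_eq_cube algebra_simps)
  \<comment> \<open>The assumption x \<noteq> t is there for this division; a single excluded point
    is a null set.\<close>
  have cubes_nz: "t ^ 3 - x ^ 3 \<noteq> 0" unfolding cubes using q x by simp
  define W where "W y = Airy_Ai (x * y) * (t * deriv Airy_Ai (t * y)) - x * deriv Airy_Ai (x * y) * Airy_Ai (t * y)" for y
  define F where "F s = - 3 * t / (t ^ 3 - x ^ 3) * W (cscale s)" for s
  define f where "f s = 3 * t * cscale s ^ 5 * (Airy_Ai (x * cscale s) * Airy_Ai (t * cscale s))" for s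
  have f_eq: "X3_density x s * T_density s t = f s" if "s > 0" for s
    using that by (simp add: X3_density_eq_cscale T_density_eq_cscale f_def power_numeral_reduce mult_ac)
  \<comment> \<open>The products of two first derivatives cancel, and Ai''(u) = u Ai(u) gives the
    factor (t^3 - x^3) y.\<close>
  have W_deriv: "(W has_real_derivative (t ^ 3 - x ^ 3) * y * (Airy_Ai (x * y) * Airy_Ai (t * y))) (at y)" for y
  proof -
    have Ai: "((\<lambda>y. Airy_Ai (a * y)) has_real_derivative deriv Airy_Ai (a * y) * a) (at y)" for a
      by (rule DERIV_chain2[OF DERIV_Airy_Ai]) (auto intro!: derivative_eq_intros)
    have Ai': "((\<lambda>y. deriv Airy_Ai (a * y)) has_real_derivative a * y * Airy_Ai (a * y) * a) (at y)" for a
      by (rule DERIV_chain2[OF DERIV_deriv_Airy_Ai]) (auto intro!: derivative_eq_intros)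
    show ?thesis
      unfolding W_def[abs_def]
      by (rule DERIV_cong[OF DERIV_diff[OF DERIV_mult[OF Ai[of x] DERIV_cmult[OF Ai'[of t], of t]]
            DERIV_mult[OF DERIV_cmult[OF Ai'[of x], of x] Ai[of t]]]])
         (simp add: algebra_simps power3_eq_cube)
  qed
  have W_cont: "isCont W y" for y using W_deriv by (rule DERIV_isCont)
  have F_deriv: "(F has_real_derivative f s) (at s)" if "s > 0" for s
  proof -
    have "((\<lambda>s. W (cscale s)) has_real_derivative
        (t ^ 3 - x ^ 3) * cscale s * (Airy_Ai (x * cscale s) * Airy_Ai (t * cscale s)) * - (cscale s ^ 4)) (at s)"
      by (rule DERIV_chain2[OF W_deriv DERIV_cscale[OF that]])
    moreover have "- 3 * t / N * (N * y * A * - (y ^ 4)) = 3 * t * y ^ 5 * A" if "N \<noteq> 0" for N y A :: real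
      using that by (simp add: power_numeral_reduce)
    ultimately show ?thesis
      unfolding F_def[abs_def] f_def using cubes_nz by (intro DERIV_cong[OF DERIV_cmult])
  qed
  have f_cont: "isCont f s" if "s > 0" for s
  proof -
    have 1: "isCont cscale s" using DERIV_cscale[OF that] by (rule DERIV_isCont)
    have 2: "isCont Airy_Ai u" for u using DERIV_Airy_Ai by (rule DERIV_isCont)
    have 3: "isCont (\<lambda>s. Airy_Ai (a * cscale s)) s" for a
      by (rule isCont_o2[OF isCont_mult[OF continuous_const 1] 2])
    show ?thesis
      unfolding f_def[abs_def] by (intro isCont_mult isCont_power continuous_const 1 3)
  qed
  \<comment> \<open>For x < 0 the bound on Ai(x y) grows with y. Choosing c |x| <= t / 2 limits this
    growth to exp (t y / 2), which exp (- t y) from Ai(t y) beats; the + 1 admits x = 0.\<close>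
  define c where "c = t / (2 * (\<bar>x\<bar> + 1))"
  have c: "c > 0" using t by (simp add: c_def)
  have cx: "c * \<bar>x\<bar> \<le> t / 2"
    using t by (simp add: c_def field_simps)
  obtain C1 where C1: "C1 > 0" "\<And>u. \<bar>Airy_Ai u\<bar> \<le> C1 * exp (- (1 * u))" "\<And>u. \<bar>deriv Airy_Ai u\<bar> \<le> C1 * exp (- (1 * u))"
    by (rule Airy_Ai_exp_bound[OF zero_less_one]) (rule that)
  obtain C2 where C2: "C2 > 0" "\<And>u. \<bar>Airy_Ai u\<bar> \<le> C2 * exp (- (c * u))" "\<And>u. \<bar>deriv Airy_Ai u\<bar> \<le> C2 * exp (- (c * u))"
    by (rule Airy_Ai_exp_bound[OF c]) (rule that)
  have prod_bound: "\<bar>a * b\<bar> \<le> C1 * C2 * exp (- (t / 2 * y))"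
    if "y \<ge> 0" "\<bar>a\<bar> \<le> C2 * exp (- (c * (x * y)))" "\<bar>b\<bar> \<le> C1 * exp (- (1 * (t * y)))" for a b y
  proof -
    have "- x * y \<le> \<bar>x\<bar> * y" using that(1) by (intro mult_right_mono) auto
    then have "c * (- x * y) \<le> c * (\<bar>x\<bar> * y)" using c by (intro mult_left_mono) auto
    then have "- (c * (x * y)) \<le> (c * \<bar>x\<bar>) * y" by (simp only: mult_minus_left mult_minus_right mult.assoc)
    also have "\<dots> \<le> t / 2 * y" using cx that(1) by (intro mult_right_mono)
    finally have e: "exp (- (c * (x * y))) \<le> exp (t / 2 * y)" by simp
    have "\<bar>a * b\<bar> \<le> (C2 * exp (- (c * (x * y)))) * (C1 * exp (- (1 * (t * y))))"
      unfolding abs_mult using that C2(1) by (intro mult_mono) auto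
    also have "\<dots> \<le> (C2 * exp (t / 2 * y)) * (C1 * exp (- (1 * (t * y))))"
      using e C1(1) C2(1) by (intro mult_right_mono mult_left_mono) auto
    also have "\<dots> = C1 * C2 * (exp (t / 2 * y) * exp (- (1 * (t * y))))" by simp
    also have "exp (t / 2 * y) * exp (- (1 * (t * y))) = exp (- (t / 2 * y))"
      by (simp add: field_simps flip: exp_add)
    finally show ?thesis .
  qed
  have W_bound: "\<bar>W y\<bar> \<le> (t + \<bar>x\<bar>) * (C1 * C2 * exp (- (t / 2 * y)))" if "y \<ge> 0" for y
  proof -
    have 1: "\<bar>Airy_Ai (x * y) * deriv Airy_Ai (t * y)\<bar> \<le> C1 * C2 * exp (- (t / 2 * y))"
      by (rule prod_bound[OF that C2(2) C1(3)])
    have 2: "\<bar>deriv Airy_Ai (x * y) * Airy_Ai (t * y)\<bar> \<le> C1 * C2 * exp (- (t / 2 * y))"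
      by (rule prod_bound[OF that C2(3) C1(2)])
    have "\<bar>W y\<bar> \<le> t * \<bar>Airy_Ai (x * y) * deriv Airy_Ai (t * y)\<bar> + \<bar>x\<bar> * \<bar>deriv Airy_Ai (x * y) * Airy_Ai (t * y)\<bar>"
      unfolding W_def using t by (intro order.trans[OF abs_triangle_ineq4]) (simp add: abs_mult mult_ac)
    also have "\<dots> \<le> t * (C1 * C2 * exp (- (t / 2 * y))) + \<bar>x\<bar> * (C1 * C2 * exp (- (t / 2 * y)))"
      using t 1 2 by (intro add_mono mult_left_mono) auto
    finally show ?thesis by (simp add: distrib_right)
  qed
  have f_int: "set_integrable lborel {0<..} f"
  proof (rule set_integrable_bound)
    show "set_integrable lborel {0<..} (\<lambda>s. 3 * t * C1 * C2 * (cscale s ^ 5 * exp (- (t / 2 * cscale s))))"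
      using t by (intro set_integrable_mult_right set_integrable_cscale5_exp) auto
    show "set_borel_measurable lborel {0<..} f"
      unfolding set_borel_measurable_def f_def by measurable
    show "AE s in lborel. s \<in> {0<..} \<longrightarrow> norm (f s) \<le> norm (3 * t * C1 * C2 * (cscale s ^ 5 * exp (- (t / 2 * cscale s))))"
    proof (intro AE_I2 impI)
      fix s :: real assume "s \<in> {0<..}"
      then have y: "cscale s > 0" by (simp add: cscale_pos)
      have "3 * t * cscale s ^ 5 * \<bar>Airy_Ai (x * cscale s) * Airy_Ai (t * cscale s)\<bar> \<le>
          3 * t * cscale s ^ 5 * (C1 * C2 * exp (- (t / 2 * cscale s)))"
        using y t by (intro mult_left_mono prod_bound C1 C2) auto
      then show "norm (f s) \<le> norm (3 * t * C1 * C2 * (cscale s ^ 5 * exp (- (t / 2 * cscale s))))"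
        using y t C1(1) C2(1) by (simp add: f_def abs_mult mult_ac)
    qed
  qed
  \<comment> \<open>The substitution reverses the ends: s at infinity corresponds to y = 0 and gives
    \<open>W 0\<close>, while s at 0 corresponds to y at infinity, where \<open>W\<close>
    vanishes.\<close>
  have "(LBINT s=0..\<infinity>. f s) = - 3 * t / (t ^ 3 - x ^ 3) * W 0 - 0"
  proof (rule interval_integral_FTC_integrable[where F = F])
    show "(F has_vector_derivative f s) (at s)" if "0 < ereal s" for s
      using F_deriv[of s] that by (simp add: has_real_derivative_iff_has_vector_derivative)
    show "isCont f s" if "0 < ereal s" for s
      using f_cont that by simp
    show "set_integrable lborel (einterval 0 \<infinity>) f"
      using f_int by (simp only: einterval_0_infinity)
    have "((\<lambda>y. (t + \<bar>x\<bar>) * (C1 * C2 * exp (- (t / 2 * y)))) \<longlongrightarrow> 0) at_top"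
      using t C1(1) C2(1) by real_asymp
    moreover have "\<forall>\<^sub>F y in at_top. norm (W y) \<le> (t + \<bar>x\<bar>) * (C1 * C2 * exp (- (t / 2 * y)))"
      using eventually_ge_at_top[of 0] by eventually_elim (use W_bound in simp)
    ultimately have "(W \<longlongrightarrow> 0) at_top"
      by (rule Lim_null_comparison[rotated])
    from tendsto_mult_right_zero[OF filterlim_compose[OF this filterlim_cscale_at_right_0]]
    have "(F \<longlongrightarrow> 0) (at_right 0)"
      unfolding F_def .
    then show "((F \<circ> real_of_ereal) \<longlongrightarrow> 0) (at_right 0)"
      by (simp add: zero_ereal_def ereal_tendsto_simps)
    have "((\<lambda>s. W (cscale s)) \<longlongrightarrow> W 0) at_top"
      by (rule isCont_tendsto_compose[OF W_cont tendsto_cscale_at_top])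
    then have "(F \<longlongrightarrow> - 3 * t / (t ^ 3 - x ^ 3) * W 0) at_top"
      unfolding F_def by (rule tendsto_mult_left)
    then show "((F \<circ> real_of_ereal) \<longlongrightarrow> - 3 * t / (t ^ 3 - x ^ 3) * W 0) (at_left \<infinity>)"
      by (simp add: ereal_tendsto_simps)
  qed auto
  also have "W 0 = (t - x) * (Airy_Ai 0 * deriv Airy_Ai 0)"
    by (simp add: W_def algebra_simps)
  also have "- 3 * t / (t ^ 3 - x ^ 3) * ((t - x) * (Airy_Ai 0 * deriv Airy_Ai 0)) - 0 = - 3 * t / q * (Airy_Ai 0 * deriv Airy_Ai 0)"
    unfolding cubes using x q by simp
  also have "\<dots> = Z1_density x t"
    unfolding Airy_Ai_0_times_deriv Z1_density_def q_def[symmetric]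
    using q by (simp add: field_simps)
  finally have "(LINT s:{0<..}|lborel. f s) = Z1_density x t"
    by (simp only: interval_lebesgue_integral_0_infty)
  moreover have "Z_density 1 x t = (LINT s:{0<..}|lborel. f s)"
    using f_eq by (auto intro!: set_lebesgue_integral_cong)
  ultimately show ?thesis by simp
qed

section \<open>Fourier transform of the first composition\<close>

lemma borel_measurable_Z1_density [measurable (raw)]:
  assumes [measurable]: "f \<in> borel_measurable M" "g \<in> borel_measurable M"
  shows "(\<lambda>x. Z1_density (f x) (g x)) \<in> borel_measurable M"
  unfolding Z1_density_def by measurable

lemma integrable_Z1_density:
  assumes t: "t > 0"
  shows "integrable lborel (\<lambda>x. Z1_density x t)"
proof -
  have "integrable lborel (\<lambda>x. 1 / (3 / 4 * t\<^sup>2 + 1 * (t / 2 + 1 * x)\<^sup>2))"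
    using t by (intro lborel_integrable_real_affine integrable_inverse_quadratic) auto
  from integrable_mult_right[OF this, of "sqrt 3 / (2 * pi) * t"]
  show ?thesis
    unfolding Z1_density_def by (simp add: power2_eq_square algebra_simps)
qed

text \<open>The real x-axis becomes the line Re q = 0 through q = i x. The sign of
  \<open>\<beta>\<close> is prescribed because exp (\<open>\<beta>\<close> q) is bounded on the
  right half-plane only for \<open>\<beta>\<close> <= 0.\<close>

lemma char_of_Z1_density_nonpos:
  assumes t: "t > 0" and \<beta>: "\<beta> \<le> 0"
  shows "char_of_density (\<lambda>x. Z1_density x t) \<beta> = exp (of_real (t * \<beta>) * Complex (sqrt 3 / 2) (- 1 / 2))"
proof -
  \<comment> \<open>\<open>\<zeta>\<close> and \<open>\<eta>\<close> are the images under q = i x of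
    the two roots of t^2 + t x + x^2, one on each side of the line.\<close>
  define \<zeta> where "\<zeta> = of_real t * Complex (sqrt 3 / 2) (- 1 / 2)"
  define \<eta> where "\<eta> = of_real t * Complex (- sqrt 3 / 2) (- 1 / 2)"
  define F where "F q = exp (of_real \<beta> * q) / (q - \<eta>)" for q
  have \<zeta>: "Re \<zeta> > 0" using t by (simp add: \<zeta>_def)
  have \<eta>: "Re \<eta> < 0" using t by (simp add: \<eta>_def)
  have diff: "\<zeta> - \<eta> = of_real (t * sqrt 3)"
    by (simp add: \<zeta>_def \<eta>_def complex_eq_iff)
  have F_hol: "F holomorphic_on {q. 0 \<le> Re q}"
    unfolding F_def using \<eta> by (intro holomorphic_intros) auto
  have F_decay: "norm (F q) \<le> 2 / norm q" if "0 \<le> Re q" "max 1 (2 * norm \<eta>) \<le> norm q" for q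
  proof -
    have "norm (exp (of_real \<beta> * q)) \<le> 1"
      using \<beta> that(1) by (simp add: mult_nonpos_nonneg)
    moreover have "norm q / 2 \<le> norm (q - \<eta>)"
      using norm_triangle_ineq2[of q \<eta>] that(2) by simp
    ultimately have "norm (F q) \<le> 1 / (norm q / 2)"
      unfolding F_def norm_divide using that(2) by (intro frac_le) auto
    then show ?thesis by simp
  qed
  have "(LINT x|lborel. F (Complex 0 x) / (\<zeta> - Complex 0 x)) = 2 * pi * F \<zeta>"
    by (rule Cauchy_integral_formula_half_plane(2)[OF F_hol \<zeta> F_decay])
  also have "F \<zeta> = exp (of_real \<beta> * \<zeta>) / of_real (t * sqrt 3)"
    by (simp add: F_def diff)
  finally have int: "(LINT x|lborel. F (Complex 0 x) / (\<zeta> - Complex 0 x)) = 2 * pi * (exp (of_real \<beta> * \<zeta>) / of_real (t * sqrt 3))" .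
  have eq: "exp (\<i> * of_real (\<beta> * x)) * of_real (Z1_density x t) =
      of_real (sqrt 3 / (2 * pi) * t) * (F (Complex 0 x) / (\<zeta> - Complex 0 x))" for x
  proof -
    have "(Complex 0 x - \<eta>) * (\<zeta> - Complex 0 x) = of_real (t\<^sup>2 + t * x + x\<^sup>2)"
      by (simp add: complex_eq_iff \<zeta>_def \<eta>_def power2_eq_square field_simps)
    moreover have "of_real \<beta> * Complex 0 x = \<i> * of_real (\<beta> * x)"
      by (simp add: complex_eq_iff)
    ultimately have "F (Complex 0 x) / (\<zeta> - Complex 0 x) = exp (\<i> * of_real (\<beta> * x)) / of_real (t\<^sup>2 + t * x + x\<^sup>2)"
      by (simp only: F_def divide_divide_eq_left)
    then show ?thesis by (simp add: Z1_density_def)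
  qed
  have "char_of_density (\<lambda>x. Z1_density x t) \<beta> =
      of_real (sqrt 3 / (2 * pi) * t) * (2 * pi * (exp (of_real \<beta> * \<zeta>) / of_real (t * sqrt 3)))"
    unfolding char_of_density_def eq integral_mult_right_zero int ..
  also have "\<dots> = exp (of_real \<beta> * \<zeta>)"
    using t by (simp add: field_simps)
  also have "of_real \<beta> * \<zeta> = of_real (t * \<beta>) * Complex (sqrt 3 / 2) (- 1 / 2)"
    by (simp add: \<zeta>_def)
  finally show ?thesis .
qed

text \<open>Conjugation, for a real density, carries the half-plane computation over to
  \<open>\<beta>\<close> > 0.\<close>

lemma char_of_density_uminus: "char_of_density p (- \<beta>) = cnj (char_of_density p \<beta>)"
proof -
  have "cnj (exp (\<i> * of_real (\<beta> * x)) * of_real (p x)) = exp (\<i> * of_real (- \<beta> * x)) * of_real (p x)" for x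
    by (simp add: exp_cnj)
  then show ?thesis
    by (simp only: char_of_density_def Bochner_Integration.integral_cnj[symmetric])
qed

lemma char_of_Z1_density:
  assumes t: "t > 0"
  shows "char_of_density (\<lambda>x. Z1_density x t) \<beta> =
    exp (- (of_real (t * \<bar>\<beta>\<bar>) * Complex (cos (pi / 6)) (sgn \<beta> * sin (pi / 6))))"
proof (cases "\<beta> \<le> 0")
  case True
  then have "of_real (t * \<beta>) * Complex (sqrt 3 / 2) (- 1 / 2) =
      - (of_real (t * \<bar>\<beta>\<bar>) * Complex (cos (pi / 6)) (sgn \<beta> * sin (pi / 6)))"
    by (cases "\<beta> = 0") (auto simp: complex_eq_iff cos_30 sin_30)
  with char_of_Z1_density_nonpos[OF t True] show ?thesis by simp
next
  case False
  then have "char_of_density (\<lambda>x. Z1_density x t) \<beta> = cnj (exp (of_real (t * - \<beta>) * Complex (sqrt 3 / 2) (- 1 / 2)))"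
    using char_of_density_uminus[of "\<lambda>x. Z1_density x t" "- \<beta>"] char_of_Z1_density_nonpos[OF t, of "- \<beta>"] by simp
  also have "\<dots> = exp (cnj (of_real (t * - \<beta>) * Complex (sqrt 3 / 2) (- 1 / 2)))"
    by (rule exp_cnj)
  also have "cnj (of_real (t * - \<beta>) * Complex (sqrt 3 / 2) (- 1 / 2)) =
      - (of_real (t * \<bar>\<beta>\<bar>) * Complex (cos (pi / 6)) (sgn \<beta> * sin (pi / 6)))"
    using False by (auto simp: complex_eq_iff cos_30 sin_30)
  finally show ?thesis .
qed

section \<open>Iterated compositions\<close>

declare Z_density.simps [simp del]

text \<open>Measurability is joint in place and time, since the next composition integrates over the
  time argument and Fubini's theorem uses both.\<close>

lemma borel_measurable_Z_density [measurable (raw)]: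
  assumes [measurable]: "f \<in> borel_measurable M" "g \<in> borel_measurable M"
  shows "(\<lambda>x. Z_density n (f x) (g x)) \<in> borel_measurable M"
proof -
  have "(\<lambda>p. Z_density n (fst p) (snd p)) \<in> borel_measurable (borel \<Otimes>\<^sub>M borel)"
  proof (induction n)
    case 0
    show ?case unfolding Z_density.simps by measurable
  next
    case (Suc n)
    have pair: "(\<lambda>q. (fst (fst q), snd q)) \<in> (borel \<Otimes>\<^sub>M borel) \<Otimes>\<^sub>M lborel \<rightarrow>\<^sub>M borel \<Otimes>\<^sub>M borel"
      by measurable
    have [measurable]: "(\<lambda>q. Z_density n (fst (fst q)) (snd q)) \<in> borel_measurable ((borel \<Otimes>\<^sub>M borel) \<Otimes>\<^sub>M lborel)"
      using measurable_compose[OF pair Suc] by simp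
    show ?case
      unfolding Z_density.simps set_lebesgue_integral_def by measurable
  qed
  from measurable_compose[OF _ this, of "\<lambda>x. (f x, g x)" M] show ?thesis by simp
qed

text \<open>The index is shifted: this belongs to \<open>Z_density (Suc n)\<close>, as the induction
  starts at the first composition.\<close>

definition Z_exponent :: "nat \<Rightarrow> real \<Rightarrow> complex" where
  "Z_exponent n \<beta> = of_real (\<bar>\<beta>\<bar> powr (1 / 3 ^ n)) *
     Complex (cos (pi / (2 * 3 ^ Suc n))) (sgn \<beta> * sin (pi / (2 * 3 ^ Suc n)))"

lemma Z_exponent_angle: "0 < pi / (2 * 3 ^ Suc n)" "pi / (2 * 3 ^ Suc n) \<le> pi / 6"
proof -
  have "(1 :: real) \<le> 3 ^ n" by (rule one_le_power) simp
  then show "pi / (2 * 3 ^ Suc n) \<le> pi / 6" by (intro divide_left_mono) auto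
qed simp

lemma Re_Z_exponent_nonneg: "Re (Z_exponent n \<beta>) \<ge> 0"
proof -
  have "cos (pi / (2 * 3 ^ Suc n)) \<ge> 0"
    using Z_exponent_angle[of n] pi_gt_zero by (intro cos_ge_zero) linarith+
  then show ?thesis by (simp add: Z_exponent_def)
qed

text \<open>The argument lies strictly between - pi and pi, so \<open>Ln\<close> recovers it exactly
  and the principal root divides it by 3.\<close>

lemma Z_exponent_Suc: "Z_exponent (Suc n) \<beta> = Z_exponent n \<beta> powr (1 / 3)"
proof (cases "\<beta> = 0")
  case False
  define \<theta> where "\<theta> = pi / (2 * 3 ^ Suc n)"
  define R where "R = \<bar>\<beta>\<bar> powr (1 / 3 ^ n)"
  have R: "R > 0" using False by (simp add: R_def)
  have \<theta>: "0 < \<theta>" "\<theta> < pi"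
    using Z_exponent_angle[of n] pi_gt_zero unfolding \<theta>_def by linarith+
  have sgn: "Complex (cos u) (sgn \<beta> * sin u) = cis (sgn \<beta> * u)" for u
    using False by (auto simp: complex_eq_iff sgn_real_def)
  have e: "of_real r * cis u = exp (Complex (ln r) u)" if "r > 0" for r u
    using that by (simp add: exp_eq_polar)
  have Z: "Z_exponent n \<beta> = exp (Complex (ln R) (sgn \<beta> * \<theta>))"
    using e[OF R] by (simp add: Z_exponent_def R_def \<theta>_def sgn)
  have "Ln (Z_exponent n \<beta>) = Complex (ln R) (sgn \<beta> * \<theta>)"
    unfolding Z using \<theta> by (intro Ln_exp) (auto simp: sgn_real_def)
  then have "Z_exponent n \<beta> powr (1 / 3) = exp (Complex (ln R) (sgn \<beta> * \<theta>) / 3)"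
    by (simp add: powr_def Z)
  also have "Complex (ln R) (sgn \<beta> * \<theta>) / 3 = Complex (ln (R powr (1 / 3))) (sgn \<beta> * (\<theta> / 3))"
    using R by (simp add: complex_eq_iff ln_powr)
  also have "exp \<dots> = of_real (R powr (1 / 3)) * cis (sgn \<beta> * (\<theta> / 3))"
    using R by (intro e[symmetric]) simp
  also have "R powr (1 / 3) = \<bar>\<beta>\<bar> powr (1 / 3 ^ Suc n)"
    by (simp add: R_def powr_powr mult.commute)
  also have "\<theta> / 3 = pi / (2 * 3 ^ Suc (Suc n))"
    by (simp add: \<theta>_def)
  finally show ?thesis by (simp add: Z_exponent_def sgn)
qed (simp add: Z_exponent_def)

lemma Z_density_char:
  "\<exists>B. \<forall>t>0. integrable lborel (\<lambda>x. Z_density (Suc n) x t) \<and>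
     (LINT x|lborel. \<bar>Z_density (Suc n) x t\<bar>) \<le> B \<and>
     (\<forall>\<beta>. char_of_density (\<lambda>x. Z_density (Suc n) x t) \<beta> = exp (- (of_real t * Z_exponent n \<beta>)))"
proof (induction n)
  case 0
  have "integrable lborel (\<lambda>x. Z_density 1 x t) \<and> (LINT x|lborel. \<bar>Z_density 1 x t\<bar>) \<le> 1 \<and>
     (\<forall>\<beta>. char_of_density (\<lambda>x. Z_density 1 x t) \<beta> = exp (- (of_real t * Z_exponent 0 \<beta>)))" if t: "t > 0" for t
  proof -
    have AE: "AE x in lborel. Z_density 1 x t = Z1_density x t"
      using AE_lborel_singleton[of t] by eventually_elim (rule Z_density_1[OF t])
    have int: "integrable lborel (\<lambda>x. Z_density 1 x t)"
      using integrable_Z1_density[OF t] by (subst integrable_cong_AE[OF _ _ AE]) auto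
    have char: "char_of_density (\<lambda>x. Z_density 1 x t) \<beta> = char_of_density (\<lambda>x. Z1_density x t) \<beta>" for \<beta>
      unfolding char_of_density_def using AE by (intro integral_cong_AE) auto
    have "complex_of_real (LINT x|lborel. Z1_density x t) = char_of_density (\<lambda>x. Z1_density x t) 0"
      by (simp add: char_of_density_def)
    also have "\<dots> = 1" using char_of_Z1_density[OF t, of 0] by simp
    finally have "(LINT x|lborel. Z1_density x t) = 1" by simp
    moreover have "(LINT x|lborel. \<bar>Z_density 1 x t\<bar>) = (LINT x|lborel. Z1_density x t)"
      using AE Z1_density_nonneg[OF t] by (intro integral_cong_AE) auto
    moreover have "char_of_density (\<lambda>x. Z_density 1 x t) \<beta> = exp (- (of_real t * Z_exponent 0 \<beta>))" for \<beta>
      unfolding char char_of_Z1_density[OF t] by (simp add: Z_exponent_def mult.assoc)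
    ultimately show ?thesis using int by simp
  qed
  then show ?case unfolding One_nat_def by blast
next
  case (Suc n)
  then obtain B where B:
    "\<And>s. s > 0 \<Longrightarrow> integrable lborel (\<lambda>x. Z_density (Suc n) x s)"
    "\<And>s. s > 0 \<Longrightarrow> (LINT x|lborel. \<bar>Z_density (Suc n) x s\<bar>) \<le> B"
    "\<And>s \<beta>. s > 0 \<Longrightarrow> char_of_density (\<lambda>x. Z_density (Suc n) x s) \<beta> = exp (- (of_real s * Z_exponent n \<beta>))"
    by blast
  obtain C where C: "C > 0" "\<And>t. t > 0 \<Longrightarrow> (LINT s:{0<..}|lborel. \<bar>T_density s t\<bar>) \<le> C"
    by (rule T_density_abs_integral_bound) (rule that)
  have B_nonneg: "B \<ge> 0"
    by (rule order.trans[OF _ B(2)[OF zero_less_one]]) simp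
  have "integrable lborel (\<lambda>x. Z_density (Suc (Suc n)) x t) \<and>
     (LINT x|lborel. \<bar>Z_density (Suc (Suc n)) x t\<bar>) \<le> B * C \<and>
     (\<forall>\<beta>. char_of_density (\<lambda>x. Z_density (Suc (Suc n)) x t) \<beta> = exp (- (of_real t * Z_exponent (Suc n) \<beta>)))"
    if t: "t > 0" for t
  proof -
    define g where "g s x = indicat_real {0<..} s *\<^sub>R (Z_density (Suc n) x s * T_density s t)" for s x
    have g_meas [measurable]: "case_prod g \<in> borel_measurable (lborel \<Otimes>\<^sub>M lborel)"
      unfolding g_def case_prod_beta by measurable
    have Z_eq: "Z_density (Suc (Suc n)) x t = (LINT s|lborel. g s x)" for x
      by (simp add: Z_density.simps(2)[of "Suc n"] g_def set_lebesgue_integral_def)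
    have T_int: "integrable lborel (\<lambda>s. B * (indicat_real {0<..} s *\<^sub>R \<bar>T_density s t\<bar>))"
      using set_integrable_abs[OF set_integrable_T_density[OF t]]
      unfolding set_integrable_def by (rule integrable_mult_right)
    have inner_norm: "(LINT x|lborel. norm (g s x)) =
        indicat_real {0<..} s *\<^sub>R ((LINT x|lborel. \<bar>Z_density (Suc n) x s\<bar>) * \<bar>T_density s t\<bar>)" for s
      by (cases "s > 0") (simp_all add: g_def abs_mult)
    have inner_bound: "(LINT x|lborel. norm (g s x)) \<le> B * (indicat_real {0<..} s *\<^sub>R \<bar>T_density s t\<bar>)" for s
      unfolding inner_norm using B(2)[of s] by (cases "s > 0") (auto intro!: mult_right_mono)
    have inner_nonneg: "(LINT x|lborel. norm (g s x)) \<ge> 0" for s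
      by (intro integral_nonneg_AE) auto
    have inner_int: "integrable lborel (\<lambda>s. LINT x|lborel. norm (g s x))"
    proof (rule Bochner_Integration.integrable_bound[OF T_int])
      show "(\<lambda>s. LINT x|lborel. norm (g s x)) \<in> borel_measurable lborel"
        by measurable
      show "AE s in lborel. norm (LINT x|lborel. norm (g s x)) \<le> norm (B * (indicat_real {0<..} s *\<^sub>R \<bar>T_density s t\<bar>))"
        using inner_bound inner_nonneg by (intro AE_I2) (simp add: order.trans[OF _ abs_ge_self])
    qed
    have g_int: "integrable (lborel \<Otimes>\<^sub>M lborel) (case_prod g)"
    proof (rule integrable_pairI[OF g_meas inner_int])
      show "integrable lborel (g s)" for s
        using B(1)[of s] by (cases "s > 0") (simp_all add: g_def[abs_def])
    qed
    have int: "integrable lborel (\<lambda>x. Z_density (Suc (Suc n)) x t)"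
      unfolding Z_eq by (rule lborel_pair.integrable_snd[OF g_int])
    have g_norm_int: "integrable (lborel \<Otimes>\<^sub>M lborel) (\<lambda>(s, x). norm (g s x))"
      using integrable_norm[OF g_int] by (simp add: case_prod_unfold)
    have "(LINT x|lborel. \<bar>Z_density (Suc (Suc n)) x t\<bar>) \<le> (LINT x|lborel. LINT s|lborel. norm (g s x))"
    proof (rule integral_mono)
      show "integrable lborel (\<lambda>x. \<bar>Z_density (Suc (Suc n)) x t\<bar>)"
        using int by (rule integrable_abs)
      show "integrable lborel (\<lambda>x. LINT s|lborel. norm (g s x))"
        by (rule lborel_pair.integrable_snd[OF g_norm_int])
      show "\<bar>Z_density (Suc (Suc n)) x t\<bar> \<le> (LINT s|lborel. norm (g s x))" for x
        unfolding Z_eq real_norm_def[symmetric] by (rule integral_norm_bound)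
    qed
    also have "\<dots> = (LINT s|lborel. LINT x|lborel. norm (g s x))"
      by (rule lborel_pair.Fubini_integral[OF g_norm_int])
    also have "\<dots> \<le> (LINT s|lborel. B * (indicat_real {0<..} s *\<^sub>R \<bar>T_density s t\<bar>))"
      by (intro integral_mono inner_int T_int inner_bound)
    also have "\<dots> = B * (LINT s:{0<..}|lborel. \<bar>T_density s t\<bar>)"
      unfolding set_lebesgue_integral_def by (rule integral_mult_right_zero)
    also have "\<dots> \<le> B * C" using B_nonneg C(2)[OF t] by (rule mult_left_mono[rotated])
    finally have bound: "(LINT x|lborel. \<bar>Z_density (Suc (Suc n)) x t\<bar>) \<le> B * C" .
    have char: "char_of_density (\<lambda>x. Z_density (Suc (Suc n)) x t) \<beta> = exp (- (of_real t * Z_exponent (Suc n) \<beta>))" for \<beta>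
    proof -
      define h where "h s x = exp (\<i> * of_real (\<beta> * x)) * complex_of_real (g s x)" for s x
      have norm_e: "norm (exp (\<i> * complex_of_real (\<beta> * x))) = 1" for x
        by (simp only: norm_exp_i_times)
      have h_int: "integrable (lborel \<Otimes>\<^sub>M lborel) (case_prod h)"
      proof (rule Bochner_Integration.integrable_bound[OF g_int])
        show "case_prod h \<in> borel_measurable (lborel \<Otimes>\<^sub>M lborel)"
          unfolding h_def case_prod_beta by measurable
        show "AE p in lborel \<Otimes>\<^sub>M lborel. norm (case_prod h p) \<le> norm (case_prod g p)"
          by (intro AE_I2) (simp add: h_def case_prod_beta norm_mult norm_e del: of_real_mult)
      qed
      have inner_x: "(LINT x|lborel. h s x) = indicat_real {0<..} s *\<^sub>R
          (exp (- (Z_exponent n \<beta> * of_real s)) * of_real (T_density s t))" for s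
      proof (cases "s > 0")
        case True
        have "(LINT x|lborel. h s x) = (LINT x|lborel. exp (\<i> * of_real (\<beta> * x)) * of_real (Z_density (Suc n) x s) * of_real (T_density s t))"
          using True by (simp add: h_def g_def mult.assoc)
        also have "\<dots> = char_of_density (\<lambda>x. Z_density (Suc n) x s) \<beta> * of_real (T_density s t)"
          unfolding char_of_density_def by (rule integral_mult_left_zero)
        finally show ?thesis
          unfolding B(3)[OF True] using True by (simp add: mult.commute)
      qed (simp add: h_def g_def)
      have "char_of_density (\<lambda>x. Z_density (Suc (Suc n)) x t) \<beta> = (LINT x|lborel. LINT s|lborel. h s x)"
        unfolding char_of_density_def h_def Z_eq integral_mult_right_zero integral_complex_of_real ..
      also have "\<dots> = (LINT s|lborel. LINT x|lborel. h s x)"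
        by (rule lborel_pair.Fubini_integral[OF h_int])
      also have "\<dots> = exp (- (of_real t * Z_exponent n \<beta> powr (1 / 3)))"
        unfolding inner_x using Laplace_T_density[OF Re_Z_exponent_nonneg t]
        by (simp add: set_lebesgue_integral_def)
      finally show ?thesis by (simp only: Z_exponent_Suc)
    qed
    show ?thesis using int bound char by blast
  qed
  then show ?case by blast
qed

theorem theorem2p13:
  fixes n :: nat and t \<beta> :: real
  assumes "n \<ge> 1" and "t > 0"
  shows "char_of_density (\<lambda>x. Z_density n x t) \<beta> =
           exp (- (of_real (t * \<bar>\<beta>\<bar> powr (1 / 3 ^ (n - 1))) *
             (of_real (cos (pi / (2 * 3 ^ n))) + \<i> * of_real (sgn \<beta> * sin (pi / (2 * 3 ^ n))))))
       \<and> exp (- (of_real (t * \<bar>\<beta>\<bar> powr (1 / 3 ^ (n - 1))) *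
             (of_real (cos (pi / (2 * 3 ^ n))) + \<i> * of_real (sgn \<beta> * sin (pi / (2 * 3 ^ n)))))) =
           exp (- (of_real (t * \<bar>\<beta>\<bar> powr (1 / 3 ^ (n - 1)) * cos (pi / (2 * 3 ^ n))) *
             (1 + \<i> * of_real (sgn \<beta> * tan (pi / (2 * 3 ^ n))))) :: complex)"
proof -
  obtain m where n: "n = Suc m" using assms(1) by (cases n) auto
  define \<theta> where "\<theta> = pi / (2 * 3 ^ n)"
  have "0 < \<theta>" "\<theta> < pi / 2"
    using Z_exponent_angle[of m] pi_gt_zero unfolding \<theta>_def n by linarith+
  then have "cos \<theta> \<noteq> 0" using cos_gt_zero[of \<theta>] by simp
  then have "cos \<theta> * tan \<theta> = sin \<theta>" by (simp add: tan_def)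
  then have eq: "of_real (cos \<theta>) + \<i> * of_real (sgn \<beta> * sin \<theta>) =
      of_real (cos \<theta>) * (1 + \<i> * complex_of_real (sgn \<beta> * tan \<theta>))"
    by (simp add: complex_eq_iff mult_ac)
  have "char_of_density (\<lambda>x. Z_density n x t) \<beta> = exp (- (of_real t * Z_exponent m \<beta>))"
    using Z_density_char[of m] assms(2) unfolding n by blast
  also have "of_real t * Z_exponent m \<beta> = of_real (t * \<bar>\<beta>\<bar> powr (1 / 3 ^ (n - 1))) *
      (of_real (cos \<theta>) + \<i> * of_real (sgn \<beta> * sin \<theta>))"
    by (simp add: Z_exponent_def n \<theta>_def Complex_eq)
  finally show ?thesis
    unfolding \<theta>_def[symmetric] eq by (simp only: of_real_mult mult.assoc simp_thms)
qed

end
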